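(* Let $s>0$, fix $y\in\mathbb{R}$ with $|y|>1$ and set $\tau:=\inf\{t\ge0:|B_t|=1\}$. Then $$\lim_{T\to\infty}\mathbb{P}_y(\tau\ge\varepsilon\,|\,\Gamma_T\le s)=0\qquad\text{for any }\varepsilon>0.$$
   Context: Under $\mathbb{P}_y$, $B=(B_t)_{t\ge0}$ is a one-dimensional Brownian motion starting in $y$. For $T\ge0$, $\Gamma_T:=\int_0^T\mathbf{1}_{\{|B_t|\ge1\}}\,\mathrm{d}t$. *)

theory Defs
  imports "HOL-Probability.Probability"
begin

text \<open>
  The time parameter of the process has type \<open>real\<close>; only the values \<open>B t\<close> with \<open>t \<ge> 0\<close> matter.
  Every path is continuous on \<open>[0, \<infinity>)\<close>, so the hitting and occupation times below are measurable.
  The starting point is only required almost surely, so that the coordinate process on path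
  space under its law started in \<open>y\<close> is an instance.
  Only the times \<open>r 0 < \<dots> < r n\<close> enter the independence condition, and every finite
  increasing list of times extends to a strictly increasing sequence \<open>r\<close>.
\<close>

locale brownian_motion = prob_space M for M :: "'a measure" +
  fixes B :: "real \<Rightarrow> 'a \<Rightarrow> real" and y :: real
  assumes random_variable: "0 \<le> t \<Longrightarrow> random_variable borel (B t)"
    and start: "AE \<omega> in M. B 0 \<omega> = y"
    and continuous_paths: "\<omega> \<in> space M \<Longrightarrow> continuous_on {0..} (\<lambda>t. B t \<omega>)"
    and gaussian_increments: "0 \<le> u \<Longrightarrow> u < t \<Longrightarrow>
      distributed M lborel (\<lambda>\<omega>. B t \<omega> - B u \<omega>) (normal_density 0 (sqrt (t - u)))"
    and independent_increments: "0 \<le> r 0 \<Longrightarrow> strict_mono r \<Longrightarrow>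
      indep_vars (\<lambda>_. borel) (\<lambda>i \<omega>. B (r (Suc i)) \<omega> - B (r i) \<omega>) {..<n :: nat}"

definition occupation_time :: "(real \<Rightarrow> 'a \<Rightarrow> real) \<Rightarrow> real \<Rightarrow> 'a \<Rightarrow> real" where
  "occupation_time B T \<omega> = (\<integral>t\<in>{0..T}. indicator {t. 1 \<le> \<bar>B t \<omega>\<bar>} t \<partial>lborel)"

text \<open>The infimum is taken in \<open>ereal\<close>, so it is \<open>\<infinity>\<close> on a path that never hits \<open>{-1, 1}\<close>.\<close>

definition hitting_time :: "(real \<Rightarrow> 'a \<Rightarrow> real) \<Rightarrow> 'a \<Rightarrow> ereal" where
  "hitting_time B \<omega> = (INF t\<in>{t. 0 \<le> t \<and> \<bar>B t \<omega>\<bar> = 1}. ereal t)"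

end

theory Submission
  imports Defs
begin

text \<open>
  Write \<open>\<Gamma>\<close> for the occupation time. All comparisons resample the path on an interval \<open>(a, b)\<close>: for
  \<open>a < m < b\<close>, the deviation of \<open>B m\<close> from the linear interpolation between \<open>B a\<close> and \<open>B b\<close> is Gaussian
  with variance \<open>(m - a) (b - m) / (b - a)\<close> and independent of the path outside \<open>(a, b)\<close>.

  If \<open>\<Gamma>\<close> is at most \<open>x\<close> up to time \<open>T\<close>, then for most starting points \<open>a\<close> both \<open>B a\<close> and \<open>B (a + h)\<close> lie in
  \<open>(-1, 1)\<close>. Moving \<open>B (a + h / 2)\<close> out of that interval costs only a constant factor and keeps
  \<open>\<Gamma> \<le> x + h\<close>. There are about \<open>T\<close> choices of \<open>a\<close>, whereas a path with \<open>\<Gamma> \<le> x + h\<close> is produced by a set of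
  \<open>a\<close> of measure at most \<open>x + h\<close>. Hence \<open>P(\<Gamma> \<le> x)\<close> is at most of order \<open>P(\<Gamma> \<le> x + h) / T\<close>.

  On the event that \<open>\<tau> \<ge> \<epsilon>\<close> and \<open>\<Gamma> \<le> s\<close>, for a positive fraction of the times \<open>t\<close> in \<open>[\<epsilon>, 2 s]\<close> one has
  \<open>\<bar>B t\<bar> < 1\<close>, and then at most \<open>s - \<epsilon>\<close> is spent outside after \<open>t\<close>. Resampling \<open>[0, t]\<close> so that at most \<open>\<epsilon> / 2\<close>
  is spent outside before \<open>t\<close> again costs a constant factor. So this event has probability at most
  of order \<open>P(\<Gamma> \<le> s - \<epsilon> / 2)\<close>, which by the above is \<open>O(P(\<Gamma> \<le> s) / T)\<close>.
\<close>

section \<open>Independence and Gaussian variables\<close>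

text \<open>The substitution \<open>x = z + p / (p + q) * w\<close>,
  \<open>x' = q / (p + q) * w - z\<close> has determinant 1 and \<open>x + x' = w\<close>. In the
  coordinates \<open>z\<close>, \<open>w\<close> the product of the two centred Gaussian densities
  of variances \<open>p\<close> and \<open>q\<close> factorises, because the mixed terms in the
  exponent cancel.\<close>

lemma normal_density_bridge:
  fixes p q w z :: real
  assumes "0 < p" "0 < q"
  shows "normal_density 0 (sqrt p) (z + p / (p + q) * w) * normal_density 0 (sqrt q) (q / (p + q) * w - z)
    = normal_density 0 (sqrt (p * q / (p + q))) z * normal_density 0 (sqrt (p + q)) w"
proof -
  have "(z + p / (p + q) * w)\<^sup>2 / (2 * p) + (q / (p + q) * w - z)\<^sup>2 / (2 * q)
      = z\<^sup>2 / (2 * (p * q / (p + q))) + w\<^sup>2 / (2 * (p + q))"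
  proof -
    have n: "p \<noteq> 0" "q \<noteq> 0" "p + q \<noteq> 0" using assms by auto
    have "((z + p / (p + q) * w)\<^sup>2 / (2 * p) + (q / (p + q) * w - z)\<^sup>2 / (2 * q)) * (2*p*q*(p+q)^2)
      = (z\<^sup>2 / (2 * (p * q / (p + q))) + w\<^sup>2 / (2 * (p + q))) * (2*p*q*(p+q)^2)"
    proof -
      \<comment> \<open>The sum is kept opaque as \<open>r\<close> while denominators are cleared,
        and is expanded only in the final polynomial identity.\<close>
      define r where "r = p + q"
      have r: "r \<noteq> 0" using n r_def by simp
      have 1: "(z + p / r * w)\<^sup>2 / (2 * p) * (2*p*q*r^2) = q * (z*r + p * w)\<^sup>2"
        using n r by (simp add: power2_eq_square field_simps)
      have 2: "(q / r * w - z)\<^sup>2 / (2 * q) * (2*p*q*r^2) = p * (q * w - z * r)\<^sup>2"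
        using n r by (simp add: power2_eq_square field_simps)
      have 3: "z\<^sup>2 / (2 * (p * q / r)) * (2*p*q*r^2) = z^2 * r^3"
        using n r by (simp add: power2_eq_square power3_eq_cube field_simps)
      have 4: "w\<^sup>2 / (2 * r) * (2*p*q*r^2) = w^2 * p * q * r"
        using n r by (simp add: power2_eq_square field_simps)
      have "q * (z*r + p * w)\<^sup>2 + p * (q * w - z * r)\<^sup>2 = z^2 * r^3 + w^2 * p * q * r"
        unfolding r_def by (simp add: power2_eq_square power3_eq_cube algebra_simps)
      then show ?thesis unfolding r_def[symmetric] distrib_right 1 2 3 4 .
    qed
    then show ?thesis using n by simp
  qed
  moreover have "sqrt (2 * pi * p) * sqrt (2 * pi * q) = sqrt (2 * pi * (p * q / (p + q))) * sqrt (2 * pi * (p + q))"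
    unfolding real_sqrt_mult[symmetric] using assms by (simp add: field_simps)
  ultimately show ?thesis using assms
    by (simp add: normal_density_def mult_exp_exp)
qed

section \<open>Independence of random variables with values in arbitrary measurable spaces\<close>

lemma Int_stable_vimage:
  assumes "Int_stable G"
  shows "Int_stable {f -` A \<inter> X | A. A \<in> G}"
proof (rule Int_stableI)
  fix a b assume "a \<in> {f -` A \<inter> X | A. A \<in> G}" "b \<in> {f -` A \<inter> X | A. A \<in> G}"
  then obtain A B where "A \<in> G" "B \<in> G" "a = f -` A \<inter> X" "b = f -` B \<inter> X" by auto
  with assms show "a \<inter> b \<in> {f -` A \<inter> X | A. A \<in> G}"
    by (intro CollectI exI[of _ "A \<inter> B"]) (auto simp: Int_stable_def)
qed

text \<open>Unlike \<open>indep_var\<close>, this relates random variables with values in different types.\<close>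

definition (in prob_space) indep_rv where
  "indep_rv S X T Y \<longleftrightarrow> random_variable S X \<and> random_variable T Y \<and>
    (\<forall>A\<in>sets S. \<forall>B\<in>sets T. prob ((X -` A \<inter> space M) \<inter> (Y -` B \<inter> space M))
      = prob (X -` A \<inter> space M) * prob (Y -` B \<inter> space M))"

text \<open>Preimages of Int-stable generators are again Int-stable and generate the preimage
  sigma-algebras, so the product formula extends from generators by the pi-lambda theorem.\<close>

lemma (in prob_space) indep_rvI_Int_stable:
  assumes X: "random_variable S X" and Y: "random_variable T Y"
    and S: "sets S = sigma_sets (space S) G" "Int_stable G" "G \<subseteq> Pow (space S)"
    and T: "sets T = sigma_sets (space T) H" "Int_stable H" "H \<subseteq> Pow (space T)"
    and prod: "\<And>A B. A \<in> G \<Longrightarrow> B \<in> H \<Longrightarrow> prob ((X -` A \<inter> space M) \<inter> (Y -` B \<inter> space M))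
      = prob (X -` A \<inter> space M) * prob (Y -` B \<inter> space M)"
  shows "indep_rv S X T Y"
proof -
  let ?A = "{X -` A \<inter> space M |A. A \<in> G}" and ?B = "{Y -` A \<inter> space M |A. A \<in> H}"
  have "?A \<subseteq> events" "?B \<subseteq> events"
    using measurable_sets[OF X] measurable_sets[OF Y] S T by auto
  then have "indep_set ?A ?B"
    unfolding indep_sets2_eq using prod by auto
  then have "indep_set (sigma_sets (space M) ?A) (sigma_sets (space M) ?B)"
    by (intro indep_set_sigma_sets Int_stable_vimage S T)
  moreover have "sigma_sets (space M) ?A = {X -` A \<inter> space M |A. A \<in> sets S}"
    unfolding S(1) using measurable_space[OF X] by (intro sigma_sets_vimage_commute[symmetric]) auto
  moreover have "sigma_sets (space M) ?B = {Y -` A \<inter> space M |A. A \<in> sets T}"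
    unfolding T(1) using measurable_space[OF Y] by (intro sigma_sets_vimage_commute[symmetric]) auto
  ultimately have "indep_set {X -` A \<inter> space M |A. A \<in> sets S} {Y -` A \<inter> space M |A. A \<in> sets T}"
    by simp
  then show ?thesis
    unfolding indep_rv_def using X Y by (auto intro!: indep_setD)
qed

lemma (in prob_space) indep_rvD:
  assumes "indep_rv S X T Y" "A \<in> sets S" "B \<in> sets T"
  shows "prob ((X -` A \<inter> space M) \<inter> (Y -` B \<inter> space M)) = prob (X -` A \<inter> space M) * prob (Y -` B \<inter> space M)"
  using assms by (auto simp: indep_rv_def)

lemma (in prob_space) indep_rv_compose:
  assumes "indep_rv S X T Y" "f \<in> measurable S S'" "g \<in> measurable T T'"
  shows "indep_rv S' (\<lambda>\<omega>. f (X \<omega>)) T' (\<lambda>\<omega>. g (Y \<omega>))"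
  unfolding indep_rv_def
proof (intro conjI ballI)
  have [measurable]: "random_variable S X" "random_variable T Y" using assms(1) by (auto simp: indep_rv_def)
  note [measurable] = assms(2,3)
  show "random_variable S' (\<lambda>\<omega>. f (X \<omega>))" "random_variable T' (\<lambda>\<omega>. g (Y \<omega>))" by measurable
  fix A B assume AB: "A \<in> sets S'" "B \<in> sets T'"
  have "(\<lambda>\<omega>. f (X \<omega>)) -` A \<inter> space M = X -` (f -` A \<inter> space S) \<inter> space M"
    "(\<lambda>\<omega>. g (Y \<omega>)) -` B \<inter> space M = Y -` (g -` B \<inter> space T) \<inter> space M"
    by (auto dest: measurable_space[OF \<open>random_variable S X\<close>] measurable_space[OF \<open>random_variable T Y\<close>])
  then show "prob ((\<lambda>\<omega>. f (X \<omega>)) -` A \<inter> space M \<inter> ((\<lambda>\<omega>. g (Y \<omega>)) -` B \<inter> space M))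
      = prob ((\<lambda>\<omega>. f (X \<omega>)) -` A \<inter> space M) * prob ((\<lambda>\<omega>. g (Y \<omega>)) -` B \<inter> space M)"
    using indep_rvD[OF assms(1) measurable_sets[OF assms(2) AB(1)] measurable_sets[OF assms(3) AB(2)]] by simp
qed

lemma (in prob_space) indep_rv_if_indep_var:
  assumes "indep_var S X T Y"
  shows "indep_rv S X T Y"
  unfolding indep_rv_def
proof (intro conjI ballI)
  fix A B assume "A \<in> sets S" "B \<in> sets T"
  from indep_varD[OF assms this]
  show "prob ((X -` A \<inter> space M) \<inter> (Y -` B \<inter> space M)) = prob (X -` A \<inter> space M) * prob (Y -` B \<inter> space M)"
    by (simp add: vimage_def Int_def conj_commute conj_left_commute)
qed (use indep_var_rv1[OF assms] indep_var_rv2[OF assms] in auto)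

text \<open>The two hypotheses split the probability of a triple event for \<open>U\<close>,
  \<open>Z\<close>, \<open>W\<close> into three factors. Regrouping them separates \<open>Z\<close>
  from \<open>U\<close> and \<open>W\<close> on rectangles, which form an Int-stable generator. It
  is applied with \<open>Z\<close> a bridge value, \<open>W\<close> the increment across its
  interval and \<open>U\<close> all other increments.\<close>

lemma (in prob_space) indep_rv_pairI:
  assumes U: "indep_rv N1 U (N2 \<Otimes>\<^sub>M N3) (\<lambda>\<omega>. (Z \<omega>, W \<omega>))" and ZW: "indep_rv N2 Z N3 W"
  shows "indep_rv N2 Z (N1 \<Otimes>\<^sub>M N3) (\<lambda>\<omega>. (U \<omega>, W \<omega>))"
proof (rule indep_rvI_Int_stable)
  have [measurable]: "U \<in> measurable M N1" "Z \<in> measurable M N2" "W \<in> measurable M N3"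
    using U ZW by (auto simp: indep_rv_def)
  show "random_variable N2 Z" "random_variable (N1 \<Otimes>\<^sub>M N3) (\<lambda>\<omega>. (U \<omega>, W \<omega>))" by auto
  show "sets N2 = sigma_sets (space N2) (sets N2)" "Int_stable (sets N2)" "sets N2 \<subseteq> Pow (space N2)"
    by (auto simp: sets.sigma_sets_eq sets.Int_stable dest: sets.sets_into_space)
  let ?H = "{a \<times> b |a b. a \<in> sets N1 \<and> b \<in> sets N3}"
  show "sets (N1 \<Otimes>\<^sub>M N3) = sigma_sets (space (N1 \<Otimes>\<^sub>M N3)) ?H" "Int_stable ?H" "?H \<subseteq> Pow (space (N1 \<Otimes>\<^sub>M N3))"
    by (auto simp: sets_pair_measure space_pair_measure Int_stable_pair_measure_generator dest: sets.sets_into_space)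
  fix A B assume A: "A \<in> sets N2" and "B \<in> ?H"
  then obtain a b where ab: "B = a \<times> b" "a \<in> sets N1" "b \<in> sets N3" by auto
  have b': "space N2 \<in> sets N2" by simp
  have ZW': "prob (Z -` A' \<inter> W -` b \<inter> space M) = prob (Z -` A' \<inter> space M) * prob (W -` b \<inter> space M)"
    if "A' \<in> sets N2" for A'
    using indep_rvD[OF ZW that ab(3)] by (simp add: vimage_def Int_def conj_commute conj_left_commute)
  have UZW: "prob (U -` a \<inter> (Z -` A' \<inter> W -` b) \<inter> space M)
      = prob (U -` a \<inter> space M) * (prob (Z -` A' \<inter> space M) * prob (W -` b \<inter> space M))"
    if "A' \<in> sets N2" for A'
    using indep_rvD[OF U ab(2), of "A' \<times> b"] that ab(3) ZW'[OF that]
    by (simp add: vimage_def Int_def conj_commute conj_left_commute)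
  have *: "Z -` space N2 \<inter> space M = space M" by (auto dest: measurable_space[OF \<open>Z \<in> measurable M N2\<close>])
  \<comment> \<open>Letting \<open>Z\<close> range over its whole space in the three-factor formula
    yields the joint law of \<open>U\<close> and \<open>W\<close>.\<close>
  have "(\<lambda>\<omega>. (U \<omega>, W \<omega>)) -` B \<inter> space M = U -` a \<inter> (Z -` space N2 \<inter> W -` b) \<inter> space M"
    using * by (auto simp: ab)
  then have 1: "prob ((\<lambda>\<omega>. (U \<omega>, W \<omega>)) -` B \<inter> space M) = prob (U -` a \<inter> space M) * prob (W -` b \<inter> space M)"
    using UZW[OF b'] by (simp add: * prob_space)
  have "(Z -` A \<inter> space M) \<inter> ((\<lambda>\<omega>. (U \<omega>, W \<omega>)) -` B \<inter> space M) = U -` a \<inter> (Z -` A \<inter> W -` b) \<inter> space M"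
    by (auto simp: ab)
  then show "prob ((Z -` A \<inter> space M) \<inter> ((\<lambda>\<omega>. (U \<omega>, W \<omega>)) -` B \<inter> space M))
      = prob (Z -` A \<inter> space M) * prob ((\<lambda>\<omega>. (U \<omega>, W \<omega>)) -` B \<inter> space M)"
    using UZW[OF A] 1 by simp
qed

text \<open>\<open>Z\<close> is the residual of \<open>X\<close> after linear regression on
  \<open>X + Y\<close>. For Gaussian variables uncorrelated means independent; here this is read off
  from the factorised joint density in \<open>normal_density_bridge\<close>.\<close>

lemma (in prob_space) gaussian_bridge:
  fixes X Y :: "'a \<Rightarrow> real"
  assumes pq: "0 < p" "0 < q"
    and X: "distributed M lborel X (normal_density 0 (sqrt p))"
    and Y: "distributed M lborel Y (normal_density 0 (sqrt q))"
    and ind: "indep_var borel X borel Y"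
  defines "Z \<equiv> \<lambda>\<omega>. X \<omega> - p / (p + q) * (X \<omega> + Y \<omega>)"
  shows "distributed M lborel Z (normal_density 0 (sqrt (p * q / (p + q))))" (is ?d)
    and "indep_rv borel Z borel (\<lambda>\<omega>. X \<omega> + Y \<omega>)" (is ?i)
proof -
  define \<theta> where "\<theta> = p / (p + q)"
  have \<theta>: "1 - \<theta> = q / (p + q)" using pq by (simp add: \<theta>_def field_simps)
  define f where "f = (\<lambda>z. ennreal (normal_density 0 (sqrt (p * q / (p + q))) z))"
  define g where "g = (\<lambda>w. ennreal (normal_density 0 (sqrt (p + q)) w))"
  have [measurable]: "f \<in> borel_measurable borel" "g \<in> borel_measurable borel"
    by (auto simp: f_def g_def)
  have [measurable]: "X \<in> borel_measurable M" "Y \<in> borel_measurable M"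
    using X Y by (auto simp: distributed_def)
  have ind': "indep_var lborel X lborel Y"
    using ind by (subst (asm) indep_var_eq, subst indep_var_eq) simp
  have J: "distributed M (lborel \<Otimes>\<^sub>M lborel) (\<lambda>x. (X x, Y x))
      (\<lambda>(x, y). ennreal (normal_density 0 (sqrt p) x) * ennreal (normal_density 0 (sqrt q) y))"
    by (intro distributed_joint_indep X Y ind') (auto intro: lborel.sigma_finite_measure_axioms)
  \<comment> \<open>This rectangle formula contains everything: \<open>R = UNIV\<close> gives the
    law of \<open>Z\<close>, \<open>S = UNIV\<close> that of the sum, and together they give
    independence.\<close>
  have key: "emeasure M {\<omega> \<in> space M. Z \<omega> \<in> S \<and> X \<omega> + Y \<omega> \<in> R} = (\<integral>\<^sup>+z\<in>S. f z \<partial>lborel) * (\<integral>\<^sup>+w\<in>R. g w \<partial>lborel)"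
    if [measurable]: "S \<in> sets borel" "R \<in> sets borel" for S R
  proof -
    let ?n = "normal_density 0"
    define Q where "Q = {(x, y). x - \<theta> * (x + y) \<in> S \<and> x + y \<in> R}"
    have "Q = {v \<in> space (borel \<Otimes>\<^sub>M borel). fst v - \<theta> * (fst v + snd v) \<in> S \<and> fst v + snd v \<in> R}"
      by (auto simp: Q_def space_pair_measure)
    also have "\<dots> \<in> sets (borel \<Otimes>\<^sub>M borel)" by measurable
    finally have [measurable]: "Q \<in> sets (borel \<Otimes>\<^sub>M borel)" "Q \<in> sets (lborel \<Otimes>\<^sub>M lborel)"
      by (simp_all cong: sets_pair_measure_cong)
    have "{\<omega> \<in> space M. Z \<omega> \<in> S \<and> X \<omega> + Y \<omega> \<in> R}
        = (\<lambda>x. (X x, Y x)) -` Q \<inter> space M"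
      by (auto simp: Z_def \<theta>_def Q_def)
    also have "emeasure M \<dots> = (\<integral>\<^sup>+v. (case v of (x, y) \<Rightarrow> ennreal (?n (sqrt p) x) * ennreal (?n (sqrt q) y)) *
        indicator Q v \<partial>(lborel \<Otimes>\<^sub>M lborel))"
      by (rule distributed_emeasure[OF J]) simp
    also have "\<dots> = (\<integral>\<^sup>+x. \<integral>\<^sup>+y. ennreal (?n (sqrt p) x) * ennreal (?n (sqrt q) y) *
        indicator Q (x, y) \<partial>lborel \<partial>lborel)"
      by (subst lborel.nn_integral_fst[symmetric]) auto
    also have "\<dots> = (\<integral>\<^sup>+x. \<integral>\<^sup>+y. ennreal (?n (sqrt p) x) * ennreal (?n (sqrt q) y) *
        (indicator S (x - \<theta> * (x + y)) * indicator R (x + y)) \<partial>lborel \<partial>lborel)"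
      by (intro nn_integral_cong) (simp add: indicator_def Q_def)
    \<comment> \<open>The change of variables is done as two translations: \<open>w = x + y\<close>
      at fixed \<open>x\<close>, then, after exchanging the integrals,
      \<open>x = \<theta> * w + z\<close> at fixed \<open>w\<close>.\<close>
    also have "\<dots> = (\<integral>\<^sup>+x. \<integral>\<^sup>+w. ennreal (?n (sqrt p) x) * ennreal (?n (sqrt q) (w - x)) *
        (indicator S (x - \<theta> * w) * indicator R w) \<partial>lborel \<partial>lborel)"
    proof (rule nn_integral_cong)
      fix x :: real
      show "(\<integral>\<^sup>+y. ennreal (?n (sqrt p) x) * ennreal (?n (sqrt q) y) *
          (indicator S (x - \<theta> * (x + y)) * indicator R (x + y)) \<partial>lborel)
        = (\<integral>\<^sup>+w. ennreal (?n (sqrt p) x) * ennreal (?n (sqrt q) (w - x)) *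
          (indicator S (x - \<theta> * w) * indicator R w) \<partial>lborel)"
        by (subst nn_integral_real_affine[where c=1 and t="-x"]) (auto simp: algebra_simps)
    qed
    also have "\<dots> = (\<integral>\<^sup>+w. \<integral>\<^sup>+x. ennreal (?n (sqrt p) x) * ennreal (?n (sqrt q) (w - x)) *
        (indicator S (x - \<theta> * w) * indicator R w) \<partial>lborel \<partial>lborel)"
      by (rule lborel_pair.Fubini'[symmetric]) measurable
    also have "\<dots> = (\<integral>\<^sup>+w. \<integral>\<^sup>+z. (f z * indicator S z) * (g w * indicator R w) \<partial>lborel \<partial>lborel)"
    proof (rule nn_integral_cong)
      fix w :: real
      have e: "?n (sqrt p) (\<theta> * w + z) * ?n (sqrt q) (w - (\<theta> * w + z))
          = ?n (sqrt (p * q / (p + q))) z * ?n (sqrt (p + q)) w" for z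
      proof -
        have 1: "w - (\<theta> * w + z) = q / (p + q) * w - z" unfolding \<theta>[symmetric] by (simp add: algebra_simps)
        have 2: "\<theta> * w + z = z + p / (p + q) * w" by (simp add: \<theta>_def)
        show ?thesis unfolding 1 unfolding 2 by (rule normal_density_bridge[OF pq])
      qed
      have "(\<integral>\<^sup>+x. ennreal (?n (sqrt p) x) * ennreal (?n (sqrt q) (w - x)) *
          (indicator S (x - \<theta> * w) * indicator R w) \<partial>lborel)
        = (\<integral>\<^sup>+z. ennreal (?n (sqrt p) (\<theta> * w + z) * ?n (sqrt q) (w - (\<theta> * w + z))) *
          (indicator S z * indicator R w) \<partial>lborel)"
        by (subst nn_integral_real_affine[where c=1 and t="\<theta> * w"]) (auto simp: ennreal_mult'')
      also have "\<dots> = (\<integral>\<^sup>+z. (f z * indicator S z) * (g w * indicator R w) \<partial>lborel)"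
        unfolding e
        by (intro nn_integral_cong) (auto simp: f_def g_def ennreal_mult'' split: split_indicator)
      finally show "(\<integral>\<^sup>+x. ennreal (?n (sqrt p) x) * ennreal (?n (sqrt q) (w - x)) *
          (indicator S (x - \<theta> * w) * indicator R w) \<partial>lborel)
        = (\<integral>\<^sup>+z. (f z * indicator S z) * (g w * indicator R w) \<partial>lborel)" .
    qed
    also have "\<dots> = (\<integral>\<^sup>+w. (\<integral>\<^sup>+z\<in>S. f z \<partial>lborel) * (g w * indicator R w) \<partial>lborel)"
      by (intro nn_integral_cong nn_integral_multc) auto
    also have "\<dots> = (\<integral>\<^sup>+z\<in>S. f z \<partial>lborel) * (\<integral>\<^sup>+w\<in>R. g w \<partial>lborel)"
      by (intro nn_integral_cmult) auto
    finally show ?thesis .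
  qed
  have [measurable]: "Z \<in> borel_measurable M" unfolding Z_def by measurable
  have f1: "(\<integral>\<^sup>+z. f z \<partial>lborel) = 1" and g1: "(\<integral>\<^sup>+z. g z \<partial>lborel) = 1"
    using pq emeasure_space_1 by (auto simp: f_def g_def nn_integral_eq_integral)
  have eZ: "emeasure M {\<omega> \<in> space M. Z \<omega> \<in> S} = (\<integral>\<^sup>+z\<in>S. f z \<partial>lborel)" if "S \<in> sets borel" for S
    using key[of S UNIV] that g1 by simp
  have eW: "emeasure M {\<omega> \<in> space M. X \<omega> + Y \<omega> \<in> R} = (\<integral>\<^sup>+w\<in>R. g w \<partial>lborel)" if "R \<in> sets borel" for R
    using key[of UNIV R] that f1 by simp
  show ?d
    unfolding distributed_def f_def[symmetric]
  proof (intro conjI)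
    show "distr M lborel Z = density lborel f"
      by (rule measure_eqI) (auto simp: emeasure_distr emeasure_density eZ[symmetric] vimage_def Int_def conj_commute)
  qed auto
  show ?i
  proof (rule indep_rvI_Int_stable)
    fix S R :: "real set" assume SR[measurable]: "S \<in> sets borel" "R \<in> sets borel"
    have *: "Z -` S \<inter> space M \<inter> ((\<lambda>\<omega>. X \<omega> + Y \<omega>) -` R \<inter> space M) = {\<omega> \<in> space M. Z \<omega> \<in> S \<and> X \<omega> + Y \<omega> \<in> R}"
      "Z -` S \<inter> space M = {\<omega> \<in> space M. Z \<omega> \<in> S}"
      "(\<lambda>\<omega>. X \<omega> + Y \<omega>) -` R \<inter> space M = {\<omega> \<in> space M. X \<omega> + Y \<omega> \<in> R}" by auto
    have "emeasure M (Z -` S \<inter> space M \<inter> ((\<lambda>\<omega>. X \<omega> + Y \<omega>) -` R \<inter> space M))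
        = emeasure M (Z -` S \<inter> space M) * emeasure M ((\<lambda>\<omega>. X \<omega> + Y \<omega>) -` R \<inter> space M)"
      unfolding *(1) key[OF SR] unfolding * eZ[OF SR(1)] eW[OF SR(2)] ..
    then show "prob (Z -` S \<inter> space M \<inter> ((\<lambda>\<omega>. X \<omega> + Y \<omega>) -` R \<inter> space M))
        = prob (Z -` S \<inter> space M) * prob ((\<lambda>\<omega>. X \<omega> + Y \<omega>) -` R \<inter> space M)"
      by (simp add: emeasure_eq_measure ennreal_mult[symmetric])
  next
    show "random_variable borel Z" "random_variable borel (\<lambda>\<omega>. X \<omega> + Y \<omega>)" by measurable
    show "sets borel = sigma_sets (space borel) (sets borel)" by (simp only: sets.sigma_sets_eq)
    then show "sets borel = sigma_sets (space borel) (sets borel)" .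
    show "Int_stable (sets borel)" by (rule sets.Int_stable)
    then show "Int_stable (sets borel)" .
    show "sets borel \<subseteq> Pow (space borel)" by (rule sets.space_closed)
    then show "sets borel \<subseteq> Pow (space borel)" .
  qed
qed

text \<open>On \<open>[-R, R]\<close> the exponential factor is smallest for the least variance and
  the normalising factor for the greatest. Taking both extremes gives a bound uniform over
  \<open>v0 \<le> v \<le> v1\<close>, which keeps the later constants independent of the resampled
  interval.\<close>

lemma (in prob_space) normal_prob_interval_ge:
  fixes Z :: "'a \<Rightarrow> real"
  assumes Z: "distributed M lborel Z (normal_density 0 (sqrt v))"
    and v: "0 < v0" "v0 \<le> v" "v \<le> v1" and u: "u \<le> w" "\<bar>u\<bar> \<le> R" "\<bar>w\<bar> \<le> R"
  shows "(w - u) * (exp (- R\<^sup>2 / (2 * v0)) / sqrt (2 * pi * v1)) \<le> prob {\<omega> \<in> space M. Z \<omega> \<in> {u..w}}"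
proof -
  let ?k = "exp (- R\<^sup>2 / (2 * v0)) / sqrt (2 * pi * v1)"
  have k: "?k \<le> normal_density 0 (sqrt v) z" if "z \<in> {u..w}" for z
  proof -
    have "\<bar>z\<bar> \<le> R" using that u by auto
    then have "z\<^sup>2 \<le> R\<^sup>2" using abs_le_square_iff[of z R] by auto
    then have "z\<^sup>2 / (2 * v) \<le> R\<^sup>2 / (2 * v0)" using v by (intro frac_le) auto
    moreover have "sqrt (2 * pi * v) \<le> sqrt (2 * pi * v1)" using v by simp
    ultimately have "?k \<le> exp (- z\<^sup>2 / (2 * v)) / sqrt (2 * pi * v)"
      using v by (intro frac_le) auto
    then show ?thesis using v by (simp add: normal_density_def)
  qed
  have "ennreal ((w - u) * ?k) = (\<integral>\<^sup>+z. ennreal ?k * indicator {u..w} z \<partial>lborel)"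
    using u v by (subst nn_integral_cmult_indicator) (auto simp: ennreal_mult'[symmetric] mult.commute)
  also have "\<dots> \<le> (\<integral>\<^sup>+z. ennreal (normal_density 0 (sqrt v) z) * indicator {u..w} z \<partial>lborel)"
    using k by (intro nn_integral_mono) (auto split: split_indicator intro!: ennreal_leI)
  also have "\<dots> = emeasure M (Z -` {u..w} \<inter> space M)"
    by (rule distributed_emeasure[OF Z, symmetric]) simp
  also have "\<dots> = ennreal (prob {\<omega> \<in> space M. Z \<omega> \<in> {u..w}})"
    unfolding emeasure_eq_measure by (intro arg_cong[where f="\<lambda>A. ennreal (prob A)"]) auto
  finally show ?thesis by (simp add: ennreal_le_iff)
qed

text \<open>Chebyshev's inequality. A bound linear in \<open>v\<close> suffices, since the variance
  of a bridge is at most a quarter of the length of its interval.\<close>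

lemma (in prob_space) normal_prob_tail_le:
  fixes Z :: "'a \<Rightarrow> real"
  assumes Z: "distributed M lborel Z (normal_density 0 (sqrt v))" and v: "0 < v" and \<delta>: "0 < \<delta>"
  shows "prob {\<omega> \<in> space M. \<delta> \<le> \<bar>Z \<omega>\<bar>} \<le> v / \<delta>\<^sup>2"
proof -
  have s: "0 < sqrt v" using v by simp
  have [measurable]: "Z \<in> borel_measurable M" using Z by (auto simp: distributed_def)
  have E: "expectation Z = 0" by (rule normal_distributed_expectation[OF s Z])
  have V: "variance Z = v" using normal_distributed_variance[OF s Z] v by simp
  have "integrable lborel (\<lambda>z. normal_density 0 (sqrt v) z * z\<^sup>2)"
    using integrable_normal_moment[OF s, of 0 2] by simp
  then have "integrable M (\<lambda>\<omega>. (Z \<omega>)\<^sup>2)"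
    using distributed_integrable[OF Z, of "\<lambda>z. z\<^sup>2"] by simp
  from Chebyshev_inequality[OF _ this \<delta>] show ?thesis unfolding V by (simp add: E)
qed

section \<open>Brownian bridges\<close>

text \<open>This puts a finite set of times into the form required by
  \<open>independent_increments\<close>, a strictly increasing infinite sequence.\<close>

lemma finite_real_set_enumeration:
  fixes F :: "real set"
  assumes F: "finite F" "F \<noteq> {}"
  obtains r :: "nat \<Rightarrow> real" where "strict_mono r" "r ` {..<card F} = F" "r 0 = Min F"
proof -
  define xs where "xs = sorted_list_of_set F"
  have xs: "sorted xs" "distinct xs" "set xs = F" "length xs = card F"
    using F by (auto simp: xs_def)
  then have n: "xs \<noteq> []" using F by auto
  \<comment> \<open>Past the end of the list the sequence continues from its last entry in unit
    steps.\<close>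
  define r where "r i = (if i < length xs then xs ! i else last xs + real (i + 1 - length xs))" for i
  have "r i < r (Suc i)" for i
  proof (cases "Suc i < length xs")
    case True
    then have "xs ! i \<le> xs ! Suc i" "xs ! i \<noteq> xs ! Suc i"
      using xs by (auto simp: sorted_nth_mono nth_eq_iff_index_eq)
    then show ?thesis using True by (auto simp: r_def)
  next
    case False
    show ?thesis
    proof (cases "i < length xs")
      case True
      with False have "i = length xs - 1" "Suc i = length xs" by auto
      then show ?thesis using n by (auto simp: r_def last_conv_nth)
    qed (use False in \<open>auto simp: r_def\<close>)
  qed
  then have 1: "strict_mono r" by (rule strict_mono_Suc_iff[THEN iffD2, rule_format])
  have 2: "r ` {..<card F} = F"
    using xs by (force simp: r_def set_conv_nth image_def)
  have "r 0 = Min F"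
  proof (rule Min_eqI[symmetric])
    have "0 < card F" using F by (simp add: card_gt_0_iff)
    then show "r 0 \<in> F" using 2 by (metis image_eqI lessThan_iff)
    fix x assume "x \<in> F"
    then obtain i where "x = r i" using 2 by auto
    then show "r 0 \<le> x" using strict_mono_less_eq[OF 1] by auto
  qed (use F in auto)
  from that[OF 1 2 this] show ?thesis .
qed

context brownian_motion
begin

text \<open>The value at time \<open>m\<close> of the Brownian bridge on \<open>[a, b]\<close>
  pinned to 0 at both ends.\<close>

definition bridge :: "real \<Rightarrow> real \<Rightarrow> real \<Rightarrow> 'a \<Rightarrow> real" where
  "bridge a m b \<omega> = B m \<omega> - ((b - m) * B a \<omega> + (m - a) * B b \<omega>) / (b - a)"

text \<open>Among the increments over the relevant times, the bridge value depends only on the two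
  over \<open>[a, m]\<close> and \<open>[m, b]\<close>, and is independent of their sum. The values
  at times in \<open>J\<close> depend only on the other increments and on that sum.\<close>

lemma bridge_indep_finite:
  assumes amb: "0 \<le> a" "a < m" "m < b"
    and J: "finite J" "J \<subseteq> {0..a} \<union> {b..}" and E: "\<And>t. t \<in> J \<Longrightarrow> E t \<in> sets borel" and S[measurable]: "S \<in> sets borel"
  shows "prob ({\<omega> \<in> space M. bridge a m b \<omega> \<in> S} \<inter> {\<omega> \<in> space M. \<forall>t\<in>J. B t \<omega> \<in> E t})
      = prob {\<omega> \<in> space M. bridge a m b \<omega> \<in> S} * prob {\<omega> \<in> space M. \<forall>t\<in>J. B t \<omega> \<in> E t}"
    and "distributed M lborel (bridge a m b) (normal_density 0 (sqrt ((m - a) * (b - m) / (b - a))))"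
proof -
  \<comment> \<open>Including 0 makes \<open>r 0 = 0\<close>, so that every value of the path
    telescopes back to the starting point.\<close>
  define F where "F = J \<union> {0, a, m, b}"
  have F: "finite F" "F \<noteq> {}" "\<And>t. t \<in> F \<Longrightarrow> 0 \<le> t" using J amb by (auto simp: F_def)
  obtain r where r: "strict_mono r" "r ` {..<card F} = F" "r 0 = Min F"
    using finite_real_set_enumeration[OF F(1,2)] by blast
  have r0: "r 0 = 0" unfolding r(3) using F by (intro Min_eqI) (auto simp: F_def)
  have rnn: "0 \<le> r i" for i
    using strict_mono_less_eq[OF r(1), of 0 i] r0 by simp
  define n where "n = card F"
  have "a \<in> r ` {..<n}" "m \<in> r ` {..<n}" "b \<in> r ` {..<n}" unfolding n_def r(2) by (auto simp: F_def)
  then obtain k j l where kj: "r k = a" "r j = m" "r l = b" "k < n" "j < n" "l < n" by auto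
  have kjl: "k < j" "j < l" using strict_mono_less[OF r(1)] kj amb by auto
  \<comment> \<open>\<open>J\<close> avoids the open interval from \<open>a\<close> to
    \<open>b\<close>, so \<open>a\<close>, \<open>m\<close>, \<open>b\<close> occupy consecutive
    indices.\<close>
  have mid: "r i = m" if "k < i" "i < l" for i
  proof -
    have "i < n" using that kj by auto
    then have "r i \<in> F" using r(2) n_def by auto
    moreover have "a < r i" "r i < b" using that kj strict_mono_less[OF r(1)] by auto
    ultimately show ?thesis using J amb by (auto simp: F_def)
  qed
  have j: "j = Suc k"
  proof (rule ccontr)
    assume "j \<noteq> Suc k"
    then have "Suc k < j" using kjl by auto
    with mid[of "Suc k"] kjl kj strict_mono_less[OF r(1), of "Suc k" j] show False by auto
  qed
  have l: "l = Suc (Suc k)"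
  proof (rule ccontr)
    assume "l \<noteq> Suc (Suc k)"
    then have "Suc j < l" using kjl j by auto
    with mid[of "Suc j"] kjl kj strict_mono_less[OF r(1), of j "Suc j"] show False by auto
  qed
  define D where "D = (\<lambda>i \<omega>. B (r (Suc i)) \<omega> - B (r i) \<omega>)"
  have ind: "indep_vars (\<lambda>_. borel) D {..<n}"
    unfolding D_def by (rule independent_increments) (use r0 r(1) in auto)
  have Dm[measurable]: "D i \<in> borel_measurable M" for i
    unfolding D_def by (intro borel_measurable_diff random_variable rnn)
  define p q where "p = m - a" and "q = b - m"
  have pq: "0 < p" "0 < q" "p + q = b - a" using amb by (auto simp: p_def q_def)
  have Dk: "distributed M lborel (D k) (normal_density 0 (sqrt p))"
    using gaussian_increments[of a m] kj j amb by (simp add: D_def p_def)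
  have Dj: "distributed M lborel (D (Suc k)) (normal_density 0 (sqrt q))"
    using gaussian_increments[of m b] kj j l amb by (simp add: D_def q_def)
  have kn: "k < n" "Suc k < n" using kj j by auto
  have Dkj: "indep_var borel (D k) borel (D (Suc k))"
    using indep_var_compose[OF indep_var_restrict[OF ind, of "{k}" "{Suc k}"], of "\<lambda>f. f k" borel "\<lambda>f. f (Suc k)" borel] kn
    by (simp add: comp_def)
  define W where "W = (\<lambda>\<omega>. D k \<omega> + D (Suc k) \<omega>)"
  define Z where "Z = (\<lambda>\<omega>. D k \<omega> - p / (p + q) * W \<omega>)"
  have Zb: "bridge a m b = Z"
  proof
    fix \<omega>
    have "b - a \<noteq> 0" using amb by auto
    then show "bridge a m b \<omega> = Z \<omega>"
      unfolding bridge_def Z_def W_def D_def using kj j l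
      by (simp add: p_def q_def field_simps)
  qed
  have "distributed M lborel Z (normal_density 0 (sqrt (p * q / (p + q))))"
    and ZW: "indep_rv borel Z borel W"
    using gaussian_bridge[OF pq(1,2) Dk Dj Dkj] unfolding Z_def W_def by auto
  then show "distributed M lborel (bridge a m b) (normal_density 0 (sqrt ((m - a) * (b - m) / (b - a))))"
    using Zb pq by (simp add: p_def q_def)
  define K where "K = {..<n} - {k, Suc k}"
  define U where "U = (\<lambda>\<omega>. restrict (\<lambda>i. D i \<omega>) K)"
  have "indep_var (PiM K (\<lambda>_. borel)) U (PiM {k, Suc k} (\<lambda>_. borel)) (\<lambda>\<omega>. restrict (\<lambda>i. D i \<omega>) {k, Suc k})"
    unfolding U_def by (rule indep_var_restrict[OF ind]) (use kn in \<open>auto simp: K_def\<close>)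
  from indep_rv_compose[OF indep_rv_if_indep_var[OF this] measurable_ident,
      where g="\<lambda>v. (v k - p / (p + q) * (v k + v (Suc k)), v k + v (Suc k))" and T'="borel \<Otimes>\<^sub>M borel"]
  have "indep_rv (PiM K (\<lambda>_. borel)) U (borel \<Otimes>\<^sub>M borel) (\<lambda>\<omega>. (Z \<omega>, W \<omega>))"
    by (simp add: Z_def W_def)
  from indep_rv_pairI[OF this ZW]
  have UW: "indep_rv borel Z (PiM K (\<lambda>_. borel) \<Otimes>\<^sub>M borel) (\<lambda>\<omega>. (U \<omega>, W \<omega>))" .
  have "\<exists>i<n. r i = t" if "t \<in> J" for t
  proof -
    have "t \<in> r ` {..<n}" using that unfolding n_def r(2) by (simp add: F_def)
    then show ?thesis by auto
  qed
  then obtain ix where ix: "\<And>t. t \<in> J \<Longrightarrow> ix t < n" "\<And>t. t \<in> J \<Longrightarrow> r (ix t) = t" by metis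
  \<comment> \<open>\<open>h t\<close> rebuilds \<open>B t\<close> from the other increments
    \<open>u\<close> and the sum \<open>w\<close>: a time at or before \<open>a\<close> contains
    neither of the two special increments, a time from \<open>b\<close> on contains both.\<close>
  define h where "h = (\<lambda>t. \<lambda>(u, w). y + (\<Sum>i\<in>{..<ix t} - {k, Suc k}. u i) + (if b \<le> t then w else 0 :: real))"
  have hm[measurable]: "h t \<in> borel_measurable (PiM K (\<lambda>_. borel) \<Otimes>\<^sub>M borel)" if "t \<in> J" for t
  proof -
    have "i \<in> K" if "i \<in> {..<ix t} - {k, Suc k}" for i using that ix[OF \<open>t \<in> J\<close>] by (auto simp: K_def)
    then show ?thesis unfolding h_def by measurable
  qed
  have hB: "h t (U \<omega>, W \<omega>) = B t \<omega>" if "B 0 \<omega> = y" "t \<in> J" for t \<omega>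
  proof -
    have "B t \<omega> = B 0 \<omega> + (\<Sum>i<ix t. D i \<omega>)"
      unfolding D_def by (subst sum_lessThan_telescope) (simp add: r0 ix that)
    moreover have "(\<Sum>i<ix t. D i \<omega>) = (\<Sum>i\<in>{..<ix t} - {k, Suc k}. U \<omega> i) + (if b \<le> t then W \<omega> else 0)"
    proof (cases "b \<le> t")
      case True
      then have "l \<le> ix t" using ix[OF that(2)] kj strict_mono_less_eq[OF r(1), of l "ix t"] by simp
      then have "{..<ix t} = insert k (insert (Suc k) ({..<ix t} - {k, Suc k}))" using l by auto
      then have "(\<Sum>i<ix t. D i \<omega>) = D k \<omega> + (D (Suc k) \<omega> + (\<Sum>i\<in>{..<ix t} - {k, Suc k}. D i \<omega>))"
        by (metis (no_types, lifting) DiffE finite_Diff finite_insert finite_lessThan insertCI insertE n_not_Suc_n sum.insert)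
      moreover have "(\<Sum>i\<in>{..<ix t} - {k, Suc k}. D i \<omega>) = (\<Sum>i\<in>{..<ix t} - {k, Suc k}. U \<omega> i)"
        using ix[OF that(2)] by (intro sum.cong) (auto simp: U_def K_def)
      ultimately show ?thesis using True by (simp add: W_def)
    next
      case False
      then have "t \<le> a" using that J by auto
      then have "ix t \<le> k" using ix[OF that(2)] kj strict_mono_less_eq[OF r(1), of "ix t" k] by simp
      then have "(\<Sum>i<ix t. D i \<omega>) = (\<Sum>i\<in>{..<ix t} - {k, Suc k}. U \<omega> i)"
        using ix[OF that(2)] by (intro sum.cong) (auto simp: U_def K_def)
      then show ?thesis using False by simp
    qed
    ultimately show ?thesis using that by (simp add: h_def)
  qed
  define Q where "Q = {v \<in> space (PiM K (\<lambda>_. borel) \<Otimes>\<^sub>M borel). \<forall>t\<in>J. h t v \<in> E t}"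
  have [measurable]: "Q \<in> sets (PiM K (\<lambda>_. borel) \<Otimes>\<^sub>M borel)"
    unfolding Q_def
  proof (intro sets.sets_Collect_finite_All J(1))
    fix t assume "t \<in> J"
    then show "{v \<in> space (PiM K (\<lambda>_. borel) \<Otimes>\<^sub>M borel). h t v \<in> E t} \<in> sets (PiM K (\<lambda>_. borel) \<Otimes>\<^sub>M borel)"
      using measurable_sets[OF hm E] by (simp add: vimage_def Int_def conj_commute)
  qed
  have [measurable]: "U \<in> measurable M (PiM K (\<lambda>_. borel))" "Z \<in> borel_measurable M" "W \<in> borel_measurable M"
    unfolding U_def Z_def W_def by measurable
  have [measurable]: "{\<omega> \<in> space M. \<forall>t\<in>J. B t \<omega> \<in> E t} \<in> sets M"
    using J E amb by (intro sets.sets_Collect_finite_All measurable_sets_Collect[OF random_variable]) auto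
  \<comment> \<open>The reconstruction uses \<open>B 0 \<omega> = y\<close>, which holds only almost
    surely, so the events are compared up to a null set.\<close>
  have AE: "AE \<omega> in M. \<omega> \<in> (\<lambda>\<omega>. (U \<omega>, W \<omega>)) -` Q \<inter> space M \<longleftrightarrow> \<omega> \<in> {\<omega> \<in> space M. \<forall>t\<in>J. B t \<omega> \<in> E t}"
    using start
  proof eventually_elim
    case (elim \<omega>)
    have "(U \<omega>, W \<omega>) \<in> space (PiM K (\<lambda>_. borel) \<Otimes>\<^sub>M borel)"
      by (auto simp: space_pair_measure space_PiM U_def)
    then show ?case using hB[OF elim] by (auto simp: Q_def)
  qed
  have 1: "prob ((\<lambda>\<omega>. (U \<omega>, W \<omega>)) -` Q \<inter> space M) = prob {\<omega> \<in> space M. \<forall>t\<in>J. B t \<omega> \<in> E t}"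
    by (rule measure_eq_AE[OF AE]) measurable
  have "prob ((Z -` S \<inter> space M) \<inter> ((\<lambda>\<omega>. (U \<omega>, W \<omega>)) -` Q \<inter> space M))
      = prob ((Z -` S \<inter> space M) \<inter> {\<omega> \<in> space M. \<forall>t\<in>J. B t \<omega> \<in> E t})"
    by (rule measure_eq_AE) (use AE in \<open>auto elim: eventually_mono\<close>)
  with 1 indep_rvD[OF UW, of S Q]
  have "prob ((Z -` S \<inter> space M) \<inter> {\<omega> \<in> space M. \<forall>t\<in>J. B t \<omega> \<in> E t})
    = prob (Z -` S \<inter> space M) * prob {\<omega> \<in> space M. \<forall>t\<in>J. B t \<omega> \<in> E t}" by simp
  then show "prob ({\<omega> \<in> space M. bridge a m b \<omega> \<in> S} \<inter> {\<omega> \<in> space M. \<forall>t\<in>J. B t \<omega> \<in> E t})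
      = prob {\<omega> \<in> space M. bridge a m b \<omega> \<in> S} * prob {\<omega> \<in> space M. \<forall>t\<in>J. B t \<omega> \<in> E t}"
    unfolding Zb by (simp add: vimage_def Int_def conj_commute)
qed

lemmas bridge_distributed = bridge_indep_finite(2)[where J = "{}" and S = "{}", simplified]

text \<open>Finite-dimensional cylinders form an Int-stable generator of the product sigma-algebra,
  and for them the claim is \<open>bridge_indep_finite\<close>.\<close>

lemma bridge_indep:
  assumes amb: "0 \<le> a" "a < m" "m < b"
  shows "indep_rv borel (bridge a m b) (PiM ({0..a} \<union> {b..}) (\<lambda>_. borel)) (\<lambda>\<omega>. \<lambda>t\<in>{0..a} \<union> {b..}. B t \<omega>)"
proof -
  define I where "I = {0..a} \<union> {b..}"
  have I: "0 \<le> t" if "t \<in> I" for t using that amb by (auto simp: I_def)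
  have [measurable]: "bridge a m b \<in> borel_measurable M"
    unfolding bridge_def using amb by (auto intro!: borel_measurable_diff borel_measurable_add borel_measurable_times borel_measurable_divide random_variable)
  have [measurable]: "(\<lambda>\<omega>. \<lambda>t\<in>I. B t \<omega>) \<in> measurable M (PiM I (\<lambda>_. borel))"
    by (intro measurable_restrict random_variable I)
  have "indep_rv borel (bridge a m b) (PiM I (\<lambda>_. borel)) (\<lambda>\<omega>. \<lambda>t\<in>I. B t \<omega>)"
  proof (rule indep_rvI_Int_stable)
    show "sets (PiM I (\<lambda>_. borel :: real measure)) = sigma_sets (space (PiM I (\<lambda>_. borel))) (prod_algebra I (\<lambda>_. borel))"
      by (simp add: sets_PiM space_PiM)
    show "Int_stable (prod_algebra I (\<lambda>_. borel :: real measure))" by (rule Int_stable_prod_algebra)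
    show "prod_algebra I (\<lambda>_. borel :: real measure) \<subseteq> Pow (space (PiM I (\<lambda>_. borel)))"
      using prod_algebra_sets_into_space[of I "\<lambda>_. borel :: real measure"] by (simp add: space_PiM)
    show "sets borel = sigma_sets (space borel) (sets borel)" by (simp only: sets.sigma_sets_eq)
    show "Int_stable (sets borel)" by (rule sets.Int_stable)
    show "sets borel \<subseteq> Pow (space borel)" by (rule sets.space_closed)
    fix S A assume S: "S \<in> sets (borel :: real measure)" and A: "A \<in> prod_algebra I (\<lambda>_. borel :: real measure)"
    from prod_algebraE[OF A] obtain J E where J: "A = prod_emb I (\<lambda>_. borel) J (\<Pi>\<^sub>E j\<in>J. E j)" "finite J" "J \<subseteq> I"
      "\<And>i. i \<in> J \<Longrightarrow> E i \<in> sets (borel :: real measure)" by metis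
    have A: "(\<lambda>\<omega>. \<lambda>t\<in>I. B t \<omega>) -` A \<inter> space M = {\<omega> \<in> space M. \<forall>t\<in>J. B t \<omega> \<in> E t}"
      using J(3) by (auto simp: J(1) prod_emb_def restrict_PiE_iff Int_absorb1)
    have S': "bridge a m b -` S \<inter> space M = {\<omega> \<in> space M. bridge a m b \<omega> \<in> S}" by auto
    show "prob (bridge a m b -` S \<inter> space M \<inter> ((\<lambda>\<omega>. \<lambda>t\<in>I. B t \<omega>) -` A \<inter> space M))
      = prob (bridge a m b -` S \<inter> space M) * prob ((\<lambda>\<omega>. \<lambda>t\<in>I. B t \<omega>) -` A \<inter> space M)"
      unfolding A S' by (rule bridge_indep_finite(1)[OF amb J(2) _ _ S]) (use J I_def in auto)
  qed measurable
  then show ?thesis unfolding I_def .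
qed

text \<open>The sigma-algebra generated by the path outside the open interval from \<open>a\<close>
  to \<open>b\<close>. As a \<open>vimage_algebra\<close>, each of its events is the preimage of a
  set of restricted paths, which is the form that independence can be applied to.\<close>

definition past_and_future :: "real \<Rightarrow> real \<Rightarrow> 'a measure" where
  "past_and_future a b = vimage_algebra (space M) (\<lambda>\<omega>. \<lambda>t\<in>{0..a} \<union> {b..}. B t \<omega>) (PiM ({0..a} \<union> {b..}) (\<lambda>_. borel))"

lemma space_past_and_future [simp]: "space (past_and_future a b) = space M"
  by (simp add: past_and_future_def)

lemma measurable_past_and_future:
  assumes "t \<in> {0..a} \<union> {b..}"
  shows "B t \<in> borel_measurable (past_and_future a b)"
proof -
  have "(\<lambda>\<omega>. \<lambda>t\<in>{0..a} \<union> {b..}. B t \<omega>) \<in> measurable (past_and_future a b) (PiM ({0..a} \<union> {b..}) (\<lambda>_. borel))"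
    unfolding past_and_future_def by (rule measurable_vimage_algebra1) (auto simp: space_PiM)
  from measurable_compose[OF this measurable_component_singleton[OF assms]]
  show ?thesis using assms by simp
qed

text \<open>This is \<open>bridge_indep\<close> for events of the sample space, the form in which
  every resampling estimate uses it.\<close>

lemma prob_bridge:
  assumes amb: "0 \<le> a" "a < m" "m < b" and A: "A \<in> sets (past_and_future a b)" and S: "S \<in> sets borel"
  shows "prob (A \<inter> {\<omega> \<in> space M. bridge a m b \<omega> \<in> S}) = prob A * prob {\<omega> \<in> space M. bridge a m b \<omega> \<in> S}"
proof -
  obtain Q where Q: "Q \<in> sets (PiM ({0..a} \<union> {b..}) (\<lambda>_. borel :: real measure))"
    "A = (\<lambda>\<omega>. \<lambda>t\<in>{0..a} \<union> {b..}. B t \<omega>) -` Q \<inter> space M"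
    using A unfolding past_and_future_def by (subst (asm) sets_vimage_algebra2) (auto simp: space_PiM)
  have "bridge a m b -` S \<inter> space M = {\<omega> \<in> space M. bridge a m b \<omega> \<in> S}" by auto
  then show ?thesis
    using indep_rvD[OF bridge_indep[OF amb] S Q(1)] by (simp add: Q(2) Int_commute mult.commute)
qed

lemma sets_past_and_future_subset:
  assumes "0 \<le> b"
  shows "sets (past_and_future a b) \<subseteq> events"
  unfolding past_and_future_def
  by (rule sets_image_in_sets) (use assms in \<open>auto intro!: measurable_restrict random_variable\<close>)

section \<open>Occupation times\<close>

text \<open>By continuity the path is the limit of step functions that round the time down to a grid
  of mesh \<open>1 / Suc n\<close>. The rounded times stay in \<open>[c, d)\<close>, so
  \<open>N\<close> only has to measure the path there; this matters for
  \<open>past_and_future\<close>.\<close>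

lemma path_measurable:
  fixes N :: "'a measure"
  assumes c: "0 \<le> c" and N: "space N = space M" "\<And>t. c \<le> t \<Longrightarrow> t < d \<Longrightarrow> B t \<in> borel_measurable N"
  shows "(\<lambda>(\<omega>, t). if c \<le> t \<and> t < d then B t \<omega> else 0) \<in> borel_measurable (N \<Otimes>\<^sub>M borel)"
proof (rule borel_measurable_LIMSEQ_real)
  \<comment> \<open>Grid points outside \<open>[c, d)\<close> get the value 0, which makes
    \<open>F n k\<close> measurable for every integer \<open>k\<close>.\<close>
  define F where "F = (\<lambda>n (k::int) \<omega>. if c \<le> c + k / real (Suc n) \<and> c + k / real (Suc n) < d
      then B (c + k / real (Suc n)) \<omega> else 0)"
  define u where "u = (\<lambda>n (\<omega>, t). if c \<le> t \<and> t < d then F n \<lfloor>(t - c) * real (Suc n)\<rfloor> \<omega> else 0)"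
  have F[measurable]: "F n k \<in> borel_measurable N" for n k
  proof (cases "c \<le> c + k / real (Suc n) \<and> c + k / real (Suc n) < d")
    case True
    have "F n k = B (c + k / real (Suc n))" unfolding F_def if_P[OF True] ..
    then show ?thesis using N(2) True by simp
  next
    case False
    have "F n k = (\<lambda>_. 0)" unfolding F_def if_not_P[OF False] ..
    then show ?thesis by simp
  qed
  show "u n \<in> borel_measurable (N \<Otimes>\<^sub>M borel)" for n
  proof -
    have "(\<lambda>p. F n \<lfloor>(snd p - c) * real (Suc n)\<rfloor> (fst p)) \<in> borel_measurable (N \<Otimes>\<^sub>M borel)"
      by (rule measurable_compose_countable) measurable
    then show ?thesis unfolding u_def case_prod_beta by measurable
  qed
  fix p :: "'a \<times> real" assume p: "p \<in> space (N \<Otimes>\<^sub>M borel)"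
  obtain \<omega> t where [simp]: "p = (\<omega>, t)" by (cases p)
  have \<omega>: "\<omega> \<in> space M" using p N(1) by (auto simp: space_pair_measure)
  show "(\<lambda>n. u n p) \<longlonglongrightarrow> (case p of (\<omega>, t) \<Rightarrow> if c \<le> t \<and> t < d then B t \<omega> else 0)"
  proof (cases "c \<le> t \<and> t < d")
    case True
    define s where "s n = c + real_of_int \<lfloor>(t - c) * real (Suc n)\<rfloor> / real (Suc n)" for n
    have s1: "c \<le> s n" "s n \<le> t" "t - 1 / real (Suc n) \<le> s n" for n
    proof -
      have "0 \<le> (t - c) * real (Suc n)" using True by simp
      then show "c \<le> s n" by (simp add: s_def)
      have "real_of_int \<lfloor>(t - c) * real (Suc n)\<rfloor> / real (Suc n) \<le> (t - c)"
        by (subst pos_divide_le_eq) auto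
      then show "s n \<le> t" by (simp add: s_def)
      have "(t - c) * real (Suc n) - 1 \<le> real_of_int \<lfloor>(t - c) * real (Suc n)\<rfloor>" by linarith
      then have "((t - c) * real (Suc n) - 1) / real (Suc n) \<le> real_of_int \<lfloor>(t - c) * real (Suc n)\<rfloor> / real (Suc n)"
        by (rule divide_right_mono) simp
      then show "t - 1 / real (Suc n) \<le> s n" by (simp add: s_def diff_divide_distrib del: of_nat_Suc)
    qed
    have "u n p = B (s n) \<omega>" for n
      using True s1[of n] by (auto simp: u_def F_def s_def simp del: of_nat_Suc)
    moreover have "s \<longlonglongrightarrow> t"
    proof (rule tendsto_sandwich)
      have "(\<lambda>n. t - 1 / real (Suc n)) \<longlonglongrightarrow> t - 0"
        by (intro tendsto_intros LIMSEQ_Suc[OF lim_1_over_n])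
      then show "(\<lambda>n. t - 1 / real (Suc n)) \<longlonglongrightarrow> t" by simp
    qed (use s1 in auto)
    then have "(\<lambda>n. B (s n) \<omega>) \<longlonglongrightarrow> B t \<omega>"
      by (rule continuous_on_tendsto_compose[OF continuous_paths[OF \<omega>]])
        (use True c order_trans[OF c s1(1)] in auto)
    ultimately show ?thesis using True by simp
  qed (auto simp: u_def)
qed

text \<open>The interval is half-open so that the occupation times of adjacent intervals add up exactly.\<close>

definition occ :: "real \<Rightarrow> real \<Rightarrow> 'a \<Rightarrow> real" where
  "occ c d \<omega> = measure lborel {t \<in> {c..<d}. 1 \<le> \<bar>B t \<omega>\<bar>}"

lemma outside_set_measurable:
  fixes N :: "'a measure"
  assumes c: "0 \<le> c" and N: "space N = space M" "\<And>t. c \<le> t \<Longrightarrow> t < d \<Longrightarrow> B t \<in> borel_measurable N"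
  shows "{p \<in> space (N \<Otimes>\<^sub>M lborel). c \<le> snd p \<and> snd p < d \<and> 1 \<le> \<bar>B (snd p) (fst p)\<bar>} \<in> sets (N \<Otimes>\<^sub>M lborel)"
proof -
  have [measurable]: "(\<lambda>(\<omega>, t). if c \<le> t \<and> t < d then B t \<omega> else 0) \<in> borel_measurable (N \<Otimes>\<^sub>M lborel)"
    using path_measurable[OF assms] by simp
  \<comment> \<open>The default value 0 off \<open>[c, d)\<close> has modulus below 1, so it adds no
    points to the set.\<close>
  have "{p \<in> space (N \<Otimes>\<^sub>M lborel). c \<le> snd p \<and> snd p < d \<and> 1 \<le> \<bar>B (snd p) (fst p)\<bar>}
    = {p \<in> space (N \<Otimes>\<^sub>M lborel). 1 \<le> \<bar>(\<lambda>(\<omega>, t). if c \<le> t \<and> t < d then B t \<omega> else 0) p\<bar>}"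
    by (auto split: if_splits)
  also have "\<dots> \<in> sets (N \<Otimes>\<^sub>M lborel)" by measurable
  finally show ?thesis .
qed

text \<open>For a fixed path the set is a section of the jointly measurable set. It is bounded, so
  the real-valued \<open>measure\<close> in \<open>occ\<close> loses nothing against
  \<open>emeasure\<close>.\<close>

lemma outside_times:
  assumes "0 \<le> c" "\<omega> \<in> space M"
  shows "{t \<in> {c..<d}. 1 \<le> \<bar>B t \<omega>\<bar>} \<in> sets borel" "emeasure lborel {t \<in> {c..<d}. 1 \<le> \<bar>B t \<omega>\<bar>} = ennreal (occ c d \<omega>)"
proof -
  have "{t \<in> {c..<d}. 1 \<le> \<bar>B t \<omega>\<bar>} = Pair \<omega> -` {p \<in> space (M \<Otimes>\<^sub>M lborel). c \<le> snd p \<and> snd p < d \<and> 1 \<le> \<bar>B (snd p) (fst p)\<bar>}"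
    using assms by (auto simp: space_pair_measure)
  also have "\<dots> \<in> sets lborel"
    by (rule sets_Pair1[OF outside_set_measurable]) (use assms random_variable in auto)
  finally show 1: "{t \<in> {c..<d}. 1 \<le> \<bar>B t \<omega>\<bar>} \<in> sets borel" by simp
  have "emeasure lborel {t \<in> {c..<d}. 1 \<le> \<bar>B t \<omega>\<bar>} \<le> emeasure lborel {c..<d}"
    by (rule emeasure_mono) auto
  also have "\<dots> < \<infinity>" by (cases "c \<le> d") auto
  finally show "emeasure lborel {t \<in> {c..<d}. 1 \<le> \<bar>B t \<omega>\<bar>} = ennreal (occ c d \<omega>)"
    unfolding occ_def by (intro emeasure_eq_ennreal_measure) (auto simp: top_unique less_top)
qed

lemma occ_nonneg [simp]: "0 \<le> occ c d \<omega>"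
  by (simp add: occ_def)

lemma occ_le:
  assumes "0 \<le> c" "c \<le> d" "\<omega> \<in> space M"
  shows "occ c d \<omega> \<le> d - c"
proof -
  have "emeasure lborel {t \<in> {c..<d}. 1 \<le> \<bar>B t \<omega>\<bar>} \<le> emeasure lborel {c..<d}"
    by (rule emeasure_mono) auto
  then show ?thesis using assms outside_times[of c \<omega> d] by simp
qed

lemma occ_split:
  assumes "0 \<le> c" "c \<le> e" "e \<le> d" "\<omega> \<in> space M"
  shows "occ c d \<omega> = occ c e \<omega> + occ e d \<omega>"
proof -
  have e: "0 \<le> e" using assms by linarith
  let ?S = "\<lambda>c d. {t \<in> {c..<d}. 1 \<le> \<bar>B t \<omega>\<bar>}"
  have 1: "?S c e \<in> sets lborel" "?S e d \<in> sets lborel"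
    by (simp_all only: sets_lborel outside_times(1)[OF assms(1,4)] outside_times(1)[OF e assms(4)])
  have 2: "?S c e \<inter> ?S e d = {}" by auto
  have 3: "?S c d = ?S c e \<union> ?S e d" using assms by auto
  have "emeasure lborel (?S c d) = emeasure lborel (?S c e) + emeasure lborel (?S e d)"
    unfolding 3 by (rule plus_emeasure[OF 1 2, symmetric])
  then have "ennreal (occ c d \<omega>) = ennreal (occ c e \<omega>) + ennreal (occ e d \<omega>)"
    by (simp only: outside_times(2)[OF assms(1,4)] outside_times(2)[OF e assms(4)])
  then show ?thesis by (simp add: ennreal_plus[symmetric] del: ennreal_plus)
qed

text \<open>Section measures of a jointly measurable set are measurable. \<open>N\<close> is kept
  general so that the result applies to \<open>past_and_future\<close> as well as to
  \<open>M\<close>.\<close>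

lemma occ_measurable:
  assumes c: "0 \<le> c" and N: "space N = space M" "\<And>t. c \<le> t \<Longrightarrow> t < d \<Longrightarrow> B t \<in> borel_measurable N"
  shows "occ c d \<in> borel_measurable N"
proof -
  let ?Q = "{p \<in> space (N \<Otimes>\<^sub>M lborel). c \<le> snd p \<and> snd p < d \<and> 1 \<le> \<bar>B (snd p) (fst p)\<bar>}"
  define g where "g = (\<lambda>\<omega>. enn2real (emeasure lborel (Pair \<omega> -` ?Q)))"
  have g: "g \<in> borel_measurable N"
    unfolding g_def
    by (intro measurable_compose[OF lborel.measurable_emeasure_Pair[OF outside_set_measurable[OF assms]]]) auto
  have "g \<omega> = occ c d \<omega>" if "\<omega> \<in> space N" for \<omega>
  proof -
    have "Pair \<omega> -` ?Q = {t \<in> {c..<d}. 1 \<le> \<bar>B t \<omega>\<bar>}" using that by (auto simp: space_pair_measure)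
    then show ?thesis by (simp add: occ_def measure_def g_def)
  qed
  then show ?thesis using g by (simp only: measurable_cong[of N g "occ c d" borel])
qed

lemma occ_random_variable [measurable]:
  "0 \<le> c \<Longrightarrow> occ c d \<in> borel_measurable M"
  by (rule occ_measurable) (auto intro: random_variable)

text \<open>The closed and the half-open time interval differ only in the null set
  \<open>{T}\<close>.\<close>

lemma occupation_time_eq:
  assumes "0 \<le> T" "\<omega> \<in> space M"
  shows "occupation_time B T \<omega> = occ 0 T \<omega>"
proof -
  let ?S = "{t. 1 \<le> \<bar>B t \<omega>\<bar>}"
  have "occupation_time B T \<omega> = (\<integral>t. indicator ({0..T} \<inter> ?S) t \<partial>lborel)"
    unfolding occupation_time_def set_lebesgue_integral_def by (simp add: indicator_inter_arith)
  also have "\<dots> = measure lborel ({0..T} \<inter> ?S)" by simp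
  also have "\<dots> = measure lborel {t \<in> {0..<T}. 1 \<le> \<bar>B t \<omega>\<bar>}"
  proof (rule measure_eq_AE)
    show "AE t in lborel. t \<in> {0..T} \<inter> ?S \<longleftrightarrow> t \<in> {t \<in> {0..<T}. 1 \<le> \<bar>B t \<omega>\<bar>}"
      using AE_lborel_singleton[of T] by eventually_elim auto
    show 1: "{t \<in> {0..<T}. 1 \<le> \<bar>B t \<omega>\<bar>} \<in> sets lborel" using outside_times assms by simp
    have "{0..T} \<inter> ?S = {t \<in> {0..<T}. 1 \<le> \<bar>B t \<omega>\<bar>} \<union> (if 1 \<le> \<bar>B T \<omega>\<bar> then {T} else {})"
      using assms by (auto simp: order_le_less)
    with 1 show "{0..T} \<inter> ?S \<in> sets lborel" by auto
  qed
  finally show ?thesis by (simp add: occ_def)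
qed

section \<open>Exchanging the integrals over time and over the probability space\<close>

definition outside_prob :: "'a set \<Rightarrow> real \<Rightarrow> real" where
  "outside_prob A t = prob (A \<inter> {\<omega> \<in> space M. 1 \<le> \<bar>B t \<omega>\<bar>})"

text \<open>Both integrals are the product measure of the set \<open>Q\<close> of pairs of a path in
  \<open>A\<close> and a time in \<open>[c, d)\<close> at which it is outside, computed by sections
  in the two directions.\<close>

lemma outside_prob_Fubini:
  assumes A[measurable]: "A \<in> events" and c: "0 \<le> c"
  shows "(\<lambda>t. outside_prob A t * indicator {c..<d} t) \<in> borel_measurable borel"
    and "(\<integral>\<^sup>+t. ennreal (outside_prob A t * indicator {c..<d} t) \<partial>lborel) = (\<integral>\<^sup>+\<omega>\<in>A. ennreal (occ c d \<omega>) \<partial>M)"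
proof -
  define Q where "Q = {p \<in> space (M \<Otimes>\<^sub>M lborel). c \<le> snd p \<and> snd p < d \<and> 1 \<le> \<bar>B (snd p) (fst p)\<bar>} \<inter> (A \<times> UNIV)"
  have Q[measurable]: "Q \<in> sets (M \<Otimes>\<^sub>M lborel)"
    unfolding Q_def by (intro sets.Int outside_set_measurable c) (auto intro: random_variable c order_trans[OF c])
  interpret P: pair_sigma_finite M "lborel :: real measure"
    by (intro pair_sigma_finite.intro sigma_finite_measure_axioms lborel.sigma_finite_measure_axioms)
  have As: "A \<subseteq> space M" using sets.sets_into_space[OF A] .
  have 1: "emeasure M ((\<lambda>\<omega>. (\<omega>, t)) -` Q) = ennreal (outside_prob A t * indicator {c..<d} t)" for t
  proof (cases "c \<le> t \<and> t < d")
    case True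
    then have "(\<lambda>\<omega>. (\<omega>, t)) -` Q = A \<inter> {\<omega> \<in> space M. 1 \<le> \<bar>B t \<omega>\<bar>}"
      using As by (auto simp: Q_def space_pair_measure)
    then show ?thesis using True by (simp add: outside_prob_def emeasure_eq_measure)
  next
    case False
    then have "(\<lambda>\<omega>. (\<omega>, t)) -` Q = {}" by (auto simp: Q_def)
    then show ?thesis using False by simp
  qed
  have "(\<lambda>t. enn2real (emeasure M ((\<lambda>\<omega>. (\<omega>, t)) -` Q))) \<in> borel_measurable lborel"
    by (intro measurable_compose[OF P.measurable_emeasure_Pair2[OF Q]]) auto
  then show "(\<lambda>t. outside_prob A t * indicator {c..<d} t) \<in> borel_measurable borel"
    unfolding 1 by (simp add: outside_prob_def)
  have 2: "emeasure lborel (Pair \<omega> -` Q) = ennreal (occ c d \<omega>) * indicator A \<omega>" if "\<omega> \<in> space M" for \<omega>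
  proof (cases "\<omega> \<in> A")
    case True
    then have "Pair \<omega> -` Q = {t \<in> {c..<d}. 1 \<le> \<bar>B t \<omega>\<bar>}"
      using As by (auto simp: Q_def space_pair_measure)
    then show ?thesis using True outside_times(2)[OF c that] by simp
  next
    case False
    then have "Pair \<omega> -` Q = {}" by (auto simp: Q_def)
    then show ?thesis using False by simp
  qed
  have "(\<integral>\<^sup>+t. emeasure M ((\<lambda>\<omega>. (\<omega>, t)) -` Q) \<partial>lborel) = emeasure (M \<Otimes>\<^sub>M lborel) Q"
    by (rule P.emeasure_pair_measure_alt2[OF Q, symmetric])
  also have "\<dots> = (\<integral>\<^sup>+\<omega>. emeasure lborel (Pair \<omega> -` Q) \<partial>M)"
    by (rule lborel.emeasure_pair_measure_alt[OF Q])
  also have "\<dots> = (\<integral>\<^sup>+\<omega>\<in>A. ennreal (occ c d \<omega>) \<partial>M)"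
    by (intro nn_integral_cong 2)
  finally show "(\<integral>\<^sup>+t. ennreal (outside_prob A t * indicator {c..<d} t) \<partial>lborel) = (\<integral>\<^sup>+\<omega>\<in>A. ennreal (occ c d \<omega>) \<partial>M)"
    unfolding 1 .
qed

text \<open>Pathwise bounds on the occupation time become bounds on a time integral of
  probabilities; pointwise inequalities in \<open>t\<close> are integrated with this.\<close>

lemma integrated_outside_prob_le:
  assumes A: "A \<in> events" and c: "0 \<le> c" and x: "\<And>\<omega>. \<omega> \<in> A \<Longrightarrow> occ c d \<omega> \<le> x" "0 \<le> x"
  shows "(\<integral>\<^sup>+t. ennreal (outside_prob A t * indicator {c..<d} t) \<partial>lborel) \<le> ennreal (x * prob A)"
proof -
  have "(\<integral>\<^sup>+\<omega>\<in>A. ennreal (occ c d \<omega>) \<partial>M) \<le> (\<integral>\<^sup>+\<omega>. ennreal x * indicator A \<omega> \<partial>M)"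
    using x by (intro nn_integral_mono) (auto split: split_indicator intro: ennreal_leI)
  also have "\<dots> = ennreal (x * prob A)"
    using A x by (simp add: nn_integral_cmult_indicator emeasure_eq_measure ennreal_mult)
  finally show ?thesis using outside_prob_Fubini(2)[OF A c] by simp
qed

section \<open>Resampling\<close>

lemma occ_past_and_future:
  assumes "0 \<le> c" "d \<le> a \<or> b \<le> c"
  shows "occ c d \<in> borel_measurable (past_and_future a b)"
  by (rule occ_measurable) (use assms in \<open>auto intro: measurable_past_and_future\<close>)

text \<open>Integrating a pointwise inequality over \<open>a\<close> in \<open>[0, T - h)\<close>
  produces all terms: the left endpoint \<open>a\<close> and the right endpoint \<open>a + h\<close>
  each cost at most \<open>x\<close> times the probability on the left, hence \<open>2 * x\<close>,
  while the midpoint contributes \<open>(x + h) / c\<close> times the probability on the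
  right.\<close>

lemma occ_trade_off:
  assumes h: "0 < h" and x: "0 \<le> x"
  obtains C where "0 \<le> C" "\<And>T. h \<le> T \<Longrightarrow> (T - h - 2 * x) * prob {\<omega> \<in> space M. occ 0 T \<omega> \<le> x}
    \<le> C * prob {\<omega> \<in> space M. occ 0 T \<omega> \<le> x + h}"
proof -
  \<comment> \<open>A lower bound for the probability that the midpoint bridge, of variance
    \<open>h / 4\<close>, falls into \<open>[2, 3]\<close>.\<close>
  define c where "c = exp (- 3\<^sup>2 / (2 * (h / 4))) / sqrt (2 * pi * (h / 4))"
  have c: "0 < c" using h by (simp add: c_def)
  have "(T - h - 2 * x) * prob {\<omega> \<in> space M. occ 0 T \<omega> \<le> x}
    \<le> (x + h) / c * prob {\<omega> \<in> space M. occ 0 T \<omega> \<le> x + h}" if T: "h \<le> T" for T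
  proof -
    define A where "A = {\<omega> \<in> space M. occ 0 T \<omega> \<le> x}"
    define G where "G = {\<omega> \<in> space M. occ 0 T \<omega> \<le> x + h}"
    have [measurable]: "A \<in> events" "G \<in> events" unfolding A_def G_def by measurable
    define f where "f = (\<lambda>A t. outside_prob A t * indicator {0..<T} t)"
    have fm[measurable]: "f A' \<in> borel_measurable borel" if "A' \<in> events" for A'
      unfolding f_def by (rule outside_prob_Fubini(1)[OF that]) simp
    have f0: "0 \<le> f A' t" for A' t by (simp add: f_def outside_prob_def)
    \<comment> \<open>On \<open>A\<close> either an endpoint of \<open>[a, a + h]\<close> is outside
      or \<open>E\<close> below holds; resampling \<open>E\<close> at the midpoint leads into
      \<open>G\<close> with the midpoint outside. The term \<open>a + 0\<close> gives all three
      summands the shifted form handled by \<open>I\<close>.\<close>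
    have pt: "prob A \<le> f A (a + 0) + f A (a + h) + f G (a + h / 2) / c" if a: "a \<in> {0..<T - h}" for a
    proof -
      define b m where "b = a + h" and "m = a + h / 2"
      have ab: "0 \<le> a" "a < m" "m < b" "b < T" "0 \<le> m" "0 \<le> b" "a < T" "m < T" using a h by (auto simp: b_def m_def)
      \<comment> \<open>The time spent outside between \<open>a\<close> and \<open>b\<close> is left
        out of \<open>E\<close>, so that \<open>E\<close> belongs to
        \<open>past_and_future a b\<close>; restoring it costs at most \<open>h\<close>.\<close>
      define E where "E = {\<omega> \<in> space M. \<bar>B a \<omega>\<bar> < 1 \<and> \<bar>B b \<omega>\<bar> < 1 \<and> occ 0 a \<omega> + occ b T \<omega> \<le> x}"
      have EN: "E \<in> sets (past_and_future a b)"
      proof -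
        have [measurable]: "B a \<in> borel_measurable (past_and_future a b)" "B b \<in> borel_measurable (past_and_future a b)"
          using ab by (auto intro!: measurable_past_and_future)
        have [measurable]: "occ 0 a \<in> borel_measurable (past_and_future a b)" "occ b T \<in> borel_measurable (past_and_future a b)"
          using ab by (auto intro!: occ_past_and_future)
        have "{\<omega> \<in> space (past_and_future a b). \<bar>B a \<omega>\<bar> < 1 \<and> \<bar>B b \<omega>\<bar> < 1 \<and> occ 0 a \<omega> + occ b T \<omega> \<le> x} \<in> sets (past_and_future a b)"
          by measurable
        then show ?thesis by (simp add: E_def)
      qed
      then have [measurable]: "E \<in> events" using sets_past_and_future_subset[OF ab(6)] by auto
      have [measurable]: "B a \<in> borel_measurable M" "B b \<in> borel_measurable M" "B m \<in> borel_measurable M"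
        using ab by (auto intro!: random_variable)
      have "(m - a) * (b - m) / (b - a) = h / 4" using h by (simp add: b_def m_def)
      then have D: "distributed M lborel (bridge a m b) (normal_density 0 (sqrt (h / 4)))"
        using bridge_distributed[OF ab(1-3)] by (simp only:)
      \<comment> \<open>With both endpoints in \<open>(-1, 1)\<close> the interpolation exceeds -1,
        so a bridge value of at least 2 puts \<open>B m\<close> above 1.\<close>
      have "(3 - 2) * c \<le> prob {\<omega> \<in> space M. bridge a m b \<omega> \<in> {2..3}}"
        unfolding c_def by (rule normal_prob_interval_ge[OF D]) (use h in auto)
      then have "prob E * c \<le> prob E * prob {\<omega> \<in> space M. bridge a m b \<omega> \<in> {2..3}}"
        by (intro mult_left_mono) auto
      also have "\<dots> = prob (E \<inter> {\<omega> \<in> space M. bridge a m b \<omega> \<in> {2..3}})"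
        by (rule prob_bridge[OF ab(1-3) EN, symmetric]) simp
      also have "\<dots> \<le> prob (G \<inter> {\<omega> \<in> space M. 1 \<le> \<bar>B m \<omega>\<bar>})"
      proof (rule finite_measure_mono)
        show "E \<inter> {\<omega> \<in> space M. bridge a m b \<omega> \<in> {2..3}} \<subseteq> G \<inter> {\<omega> \<in> space M. 1 \<le> \<bar>B m \<omega>\<bar>}"
        proof
          fix \<omega> assume w: "\<omega> \<in> E \<inter> {\<omega> \<in> space M. bridge a m b \<omega> \<in> {2..3}}"
          then have \<omega>: "\<omega> \<in> space M" "\<bar>B a \<omega>\<bar> < 1" "\<bar>B b \<omega>\<bar> < 1" "occ 0 a \<omega> + occ b T \<omega> \<le> x" "2 \<le> bridge a m b \<omega>"
            by (auto simp: E_def)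
          have "occ 0 T \<omega> = occ 0 a \<omega> + occ a b \<omega> + occ b T \<omega>"
            using occ_split[of 0 a T \<omega>] occ_split[of a b T \<omega>] ab \<omega> by simp
          moreover have "occ a b \<omega> \<le> h" using occ_le[of a b \<omega>] ab \<omega> by (simp add: b_def)
          moreover have "bridge a m b \<omega> = B m \<omega> - (B a \<omega> + B b \<omega>) / 2"
            using h by (simp add: bridge_def b_def m_def field_simps)
          moreover have "1 \<le> \<bar>B m \<omega>\<bar>"
          proof -
            have "- 1 < B a \<omega>" "- 1 < B b \<omega>" using \<omega>(2,3) by (auto simp: abs_less_iff)
            then have "1 \<le> B m \<omega>" using \<omega>(5) unfolding calculation(3) add_divide_distrib by linarith
            then show ?thesis by simp
          qed
          ultimately show "\<omega> \<in> G \<inter> {\<omega> \<in> space M. 1 \<le> \<bar>B m \<omega>\<bar>}" using \<omega> by (auto simp: G_def)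
        qed
      qed measurable
      finally have 1: "prob E \<le> f G m / c"
        using c ab by (simp add: f_def outside_prob_def field_simps)
      have "A \<subseteq> (A \<inter> {\<omega> \<in> space M. 1 \<le> \<bar>B a \<omega>\<bar>}) \<union> (A \<inter> {\<omega> \<in> space M. 1 \<le> \<bar>B b \<omega>\<bar>}) \<union> E"
      proof
        fix \<omega> assume w: "\<omega> \<in> A"
        then have \<omega>: "\<omega> \<in> space M" "occ 0 T \<omega> \<le> x" by (auto simp: A_def)
        have "occ 0 T \<omega> = occ 0 a \<omega> + occ a b \<omega> + occ b T \<omega>"
          using occ_split[of 0 a T \<omega>] occ_split[of a b T \<omega>] ab \<omega> by simp
        with occ_nonneg[of a b \<omega>] \<omega>(2) have "occ 0 a \<omega> + occ b T \<omega> \<le> x" by linarith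
        then show "\<omega> \<in> (A \<inter> {\<omega> \<in> space M. 1 \<le> \<bar>B a \<omega>\<bar>}) \<union> (A \<inter> {\<omega> \<in> space M. 1 \<le> \<bar>B b \<omega>\<bar>}) \<union> E"
          using w \<omega> by (auto simp: E_def)
      qed
      then have "prob A \<le> prob ((A \<inter> {\<omega> \<in> space M. 1 \<le> \<bar>B a \<omega>\<bar>}) \<union> (A \<inter> {\<omega> \<in> space M. 1 \<le> \<bar>B b \<omega>\<bar>}) \<union> E)"
        by (intro finite_measure_mono) measurable
      also have "\<dots> \<le> prob ((A \<inter> {\<omega> \<in> space M. 1 \<le> \<bar>B a \<omega>\<bar>}) \<union> (A \<inter> {\<omega> \<in> space M. 1 \<le> \<bar>B b \<omega>\<bar>})) + prob E"
        by (rule measure_Un_le) measurable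
      also have "\<dots> \<le> prob (A \<inter> {\<omega> \<in> space M. 1 \<le> \<bar>B a \<omega>\<bar>}) + prob (A \<inter> {\<omega> \<in> space M. 1 \<le> \<bar>B b \<omega>\<bar>}) + prob E"
        by (intro add_right_mono measure_Un_le) measurable
      also have "\<dots> = f A a + f A b + prob E" using ab by (simp add: f_def outside_prob_def)
      finally show ?thesis using 1 by (simp add: b_def m_def)
    qed
    \<comment> \<open>Since \<open>f\<close> vanishes off \<open>[0, T)\<close>, the integral runs
      over the whole line and is invariant under the shift by \<open>k\<close>.\<close>
    have I: "(\<integral>\<^sup>+t. ennreal (f A' (t + k)) \<partial>lborel) \<le> ennreal (z * prob A')"
      if "A' \<in> events" "\<And>\<omega>. \<omega> \<in> A' \<Longrightarrow> occ 0 T \<omega> \<le> z" "0 \<le> z" for A' z k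
    proof -
      have "(\<integral>\<^sup>+t. ennreal (f A' (t + k)) \<partial>lborel) = (\<integral>\<^sup>+t. ennreal (f A' t) \<partial>lborel)"
        using nn_integral_real_affine[of "\<lambda>t. ennreal (f A' t)" 1 k] fm[OF that(1)] by (simp add: add.commute)
      also have "\<dots> \<le> ennreal (z * prob A')"
        unfolding f_def by (rule integrated_outside_prob_le[OF that(1) _ that(2,3)]) auto
      finally show ?thesis .
    qed
    have "ennreal ((T - h) * prob A) = (\<integral>\<^sup>+a. ennreal (prob A) * indicator {0..<T - h} a \<partial>lborel)"
      using T by (subst nn_integral_cmult_indicator) (auto simp: ennreal_mult' mult.commute)
    also have "\<dots> \<le> (\<integral>\<^sup>+a. ennreal (f A (a + 0)) + ennreal (f A (a + h)) + ennreal (1 / c) * ennreal (f G (a + h / 2)) \<partial>lborel)"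
    proof (rule nn_integral_mono)
      fix a :: real
      show "ennreal (prob A) * indicator {0..<T - h} a \<le> ennreal (f A (a + 0)) + ennreal (f A (a + h)) + ennreal (1 / c) * ennreal (f G (a + h / 2))"
      proof (cases "a \<in> {0..<T - h}")
        case True
        have "ennreal (prob A) \<le> ennreal (f A (a + 0) + f A (a + h) + f G (a + h / 2) / c)"
          by (rule ennreal_leI[OF pt[OF True]])
        also have "\<dots> = ennreal (f A (a + 0)) + ennreal (f A (a + h)) + ennreal (1 / c) * ennreal (f G (a + h / 2))"
          using f0 c by (simp add: ennreal_plus ennreal_mult'[symmetric])
        finally show ?thesis using True by simp
      qed simp
    qed
    also have "\<dots> = (\<integral>\<^sup>+a. ennreal (f A (a + 0)) \<partial>lborel) + (\<integral>\<^sup>+a. ennreal (f A (a + h)) \<partial>lborel)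
        + ennreal (1 / c) * (\<integral>\<^sup>+a. ennreal (f G (a + h / 2)) \<partial>lborel)"
      by (simp add: nn_integral_add nn_integral_cmult)
    also have "\<dots> \<le> ennreal (x * prob A) + ennreal (x * prob A) + ennreal (1 / c) * ennreal ((x + h) * prob G)"
      using x h by (intro add_mono mult_left_mono I) (auto simp: A_def G_def)
    also have "\<dots> = ennreal (2 * (x * prob A) + (x + h) / c * prob G)"
      using x h c by (simp add: ennreal_plus[symmetric] ennreal_mult'[symmetric] del: ennreal_plus)
    finally have "(T - h) * prob A \<le> 2 * (x * prob A) + (x + h) / c * prob G"
      using x h c by (subst (asm) ennreal_le_iff) auto
    then show ?thesis unfolding A_def G_def by (simp add: algebra_simps)
  qed
  with that[of "(x + h) / c"] x h c show ?thesis by simp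
qed

text \<open>
  Only products of an event and a bridge event can be handled by independence, so the values of the
  interpolation are covered by finitely many intervals of length \<open>1 / 2\<close>.
\<close>

lemma bridge_pull_in:
  assumes v0: "0 < v0" and v1: "0 \<le> v1" and K: "0 \<le> K"
  shows "\<exists>C\<ge>0. \<forall>a m b. 0 \<le> a \<and> a < m \<and> m < b \<and> v0 \<le> (m - a) * (b - m) / (b - a) \<and> (m - a) * (b - m) / (b - a) \<le> v1 \<longrightarrow>
      (\<forall>E\<in>sets (past_and_future a b). (\<forall>\<omega>\<in>E. \<bar>B a \<omega>\<bar> \<le> K \<and> \<bar>B b \<omega>\<bar> \<le> K) \<longrightarrow>
      prob E \<le> C * prob (E \<inter> {\<omega> \<in> space M. \<bar>B m \<omega>\<bar> \<le> 1 / 2}))"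
proof -
  \<comment> \<open>A lower bound for the probability that the bridge hits a prescribed interval of
    length \<open>1 / 2\<close> inside \<open>[-(K + 1), K + 1]\<close>.\<close>
  define c where "c = (1 / 2) * (exp (- (K + 1)\<^sup>2 / (2 * v0)) / sqrt (2 * pi * v1))"
  \<comment> \<open>The interpolation lies in \<open>[-K, K]\<close>, which these many intervals of
    length \<open>1 / 2\<close>, starting at \<open>-K\<close>, cover.\<close>
  define N where "N = nat \<lceil>4 * K\<rceil> + 1"
  have N: "4 * K < real N" "real N < 4 * K + 2" unfolding N_def using K by linarith+
  have "prob E \<le> real N / c * prob (E \<inter> {\<omega> \<in> space M. \<bar>B m \<omega>\<bar> \<le> 1 / 2})"
    if amb: "0 \<le> a" "a < m" "m < b" and v: "v0 \<le> (m - a) * (b - m) / (b - a)" "(m - a) * (b - m) / (b - a) \<le> v1"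
      and E: "E \<in> sets (past_and_future a b)" and EK: "\<And>\<omega>. \<omega> \<in> E \<Longrightarrow> \<bar>B a \<omega>\<bar> \<le> K \<and> \<bar>B b \<omega>\<bar> \<le> K"
    for a m b E
  proof -
    have "0 < v1" using v v0 by linarith
    then have c: "0 < c" by (simp add: c_def)
    define X where "X = (\<lambda>\<omega>. ((b - m) * B a \<omega> + (m - a) * B b \<omega>) / (b - a))"
    have Bm: "B m \<omega> = bridge a m b \<omega> + X \<omega>" for \<omega> by (simp add: bridge_def X_def)
    have X: "\<bar>X \<omega>\<bar> \<le> K" if "\<omega> \<in> E" for \<omega>
    proof -
      have "\<bar>(b - m) * B a \<omega> + (m - a) * B b \<omega>\<bar> \<le> (b - m) * K + (m - a) * K"
        using EK[OF that] amb by (intro order_trans[OF abs_triangle_ineq] add_mono) (auto simp: abs_mult intro!: mult_left_mono)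
      also have "\<dots> = K * (b - a)" by (simp add: algebra_simps)
      finally show ?thesis using amb by (simp add: X_def divide_le_eq)
    qed
    have [measurable]: "B a \<in> borel_measurable (past_and_future a b)" "B b \<in> borel_measurable (past_and_future a b)"
      using amb by (auto intro!: measurable_past_and_future)
    have Xm[measurable]: "X \<in> borel_measurable (past_and_future a b)" unfolding X_def by measurable
    have [measurable]: "E \<in> events" "B m \<in> borel_measurable M"
      using E sets_past_and_future_subset[of b a] amb by (auto intro!: random_variable)
    have D: "distributed M lborel (bridge a m b) (normal_density 0 (sqrt ((m - a) * (b - m) / (b - a))))"
      by (rule bridge_distributed[OF amb])
    define G where "G = E \<inter> {\<omega> \<in> space M. \<bar>B m \<omega>\<bar> \<le> 1 / 2}"
    define x where "x = (\<lambda>i::nat. real i / 2 - K)"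
    define E' where "E' = (\<lambda>i. E \<inter> {\<omega> \<in> space (past_and_future a b). x i \<le> X \<omega> \<and> X \<omega> \<le> x i + 1 / 2})"
    have E'N: "E' i \<in> sets (past_and_future a b)" for i
    proof -
      have "{\<omega> \<in> space (past_and_future a b). x i \<le> X \<omega> \<and> X \<omega> \<le> x i + 1 / 2} \<in> sets (past_and_future a b)"
        by measurable
      then show ?thesis unfolding E'_def by (intro sets.Int E)
    qed
    then have E'M: "E' i \<in> events" for i using sets_past_and_future_subset[of b a] amb by auto
    have piece: "prob (E' i) \<le> prob G / c" if "i < N" for i
    proof -
      have xi: "\<bar>- x i - 1 / 2\<bar> \<le> K + 1" "\<bar>- x i\<bar> \<le> K + 1"
      proof -
        have "real i + 1 \<le> real N" using that by linarith
        with N have "real i < 4 * K + 1" by linarith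
        then show "\<bar>- x i - 1 / 2\<bar> \<le> K + 1" "\<bar>- x i\<bar> \<le> K + 1" unfolding x_def using K by (auto simp: abs_le_iff)
      qed
      \<comment> \<open>An interpolation value in \<open>[x i, x i + 1 / 2]\<close> plus a bridge
        value in \<open>[- x i - 1 / 2, - x i]\<close> has modulus at most
        \<open>1 / 2\<close>.\<close>
      have "c \<le> prob {\<omega> \<in> space M. bridge a m b \<omega> \<in> {- x i - 1 / 2..- x i}}"
        using normal_prob_interval_ge[OF D v0 v _ xi] by (simp add: c_def)
      then have "prob (E' i) * c \<le> prob (E' i) * prob {\<omega> \<in> space M. bridge a m b \<omega> \<in> {- x i - 1 / 2..- x i}}"
        by (intro mult_left_mono) auto
      also have "\<dots> = prob (E' i \<inter> {\<omega> \<in> space M. bridge a m b \<omega> \<in> {- x i - 1 / 2..- x i}})"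
        by (rule prob_bridge[OF amb E'N, symmetric]) simp
      also have "\<dots> \<le> prob G"
      proof (rule finite_measure_mono)
        show "E' i \<inter> {\<omega> \<in> space M. bridge a m b \<omega> \<in> {- x i - 1 / 2..- x i}} \<subseteq> G"
        proof
          fix \<omega> assume "\<omega> \<in> E' i \<inter> {\<omega> \<in> space M. bridge a m b \<omega> \<in> {- x i - 1 / 2..- x i}}"
          then have \<omega>: "\<omega> \<in> E" "\<omega> \<in> space M" "- x i - 1 / 2 \<le> bridge a m b \<omega>" "bridge a m b \<omega> \<le> - x i"
            "x i \<le> X \<omega>" "X \<omega> \<le> x i + 1 / 2" by (auto simp: E'_def)
          have "\<bar>B m \<omega>\<bar> \<le> 1 / 2" unfolding Bm by (rule abs_leI) (use \<omega> in linarith)+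
          with \<omega> show "\<omega> \<in> G" by (simp add: G_def)
        qed
        show "G \<in> events" unfolding G_def by measurable
      qed
      finally show ?thesis using c by (simp add: field_simps)
    qed
    have "E \<subseteq> (\<Union>i<N. E' i)"
    proof
      fix \<omega> assume w: "\<omega> \<in> E"
      define i where "i = nat \<lfloor>2 * (X \<omega> + K)\<rfloor>"
      have "0 \<le> 2 * (X \<omega> + K)" "2 * (X \<omega> + K) \<le> 4 * K" using X[OF w] by (auto simp: abs_le_iff)
      then have i: "real i \<le> 2 * (X \<omega> + K)" "2 * (X \<omega> + K) < real i + 1" "i < N"
        unfolding i_def N_def by linarith+
      then have "x i \<le> X \<omega>" "X \<omega> \<le> x i + 1 / 2" by (auto simp: x_def)
      moreover have "\<omega> \<in> space M" using w sets.sets_into_space[OF \<open>E \<in> events\<close>] by auto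
      ultimately show "\<omega> \<in> (\<Union>i<N. E' i)" using w i(3) by (auto simp: E'_def)
    qed
    then have "prob E \<le> prob (\<Union>i<N. E' i)"
      using E'M by (intro finite_measure_mono) auto
    also have "\<dots> \<le> (\<Sum>i<N. prob (E' i))"
      using E'M by (intro finite_measure_subadditive_finite) auto
    also have "\<dots> \<le> (\<Sum>i<N. prob G / c)" by (intro sum_mono piece) auto
    finally show ?thesis by (simp add: G_def)
  qed
  then have *: "\<forall>a m b. 0 \<le> a \<and> a < m \<and> m < b \<and> v0 \<le> (m - a) * (b - m) / (b - a) \<and> (m - a) * (b - m) / (b - a) \<le> v1 \<longrightarrow>
      (\<forall>E\<in>sets (past_and_future a b). (\<forall>\<omega>\<in>E. \<bar>B a \<omega>\<bar> \<le> K \<and> \<bar>B b \<omega>\<bar> \<le> K) \<longrightarrow>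
      prob E \<le> real N / c * prob (E \<inter> {\<omega> \<in> space M. \<bar>B m \<omega>\<bar> \<le> 1 / 2}))"
    by blast
  \<comment> \<open>For \<open>v1 = 0\<close> both \<open>c\<close> and the quotient are 0 by the
    convention for division; positivity of \<open>c\<close> is derived above only where the variance
    bounds hold.\<close>
  have "0 \<le> real N / c" by (simp add: c_def v1)
  with * show ?thesis by blast
qed

text \<open>
  The points of a grid of \<open>[0, t]\<close> are forced into \<open>[-1/2, 1/2]\<close> one after the other. If the mesh is
  small, Chebyshev's inequality keeps the bridges between them below \<open>1/2\<close> most of the time; the first
  and the last grid interval are given up.
\<close>

lemma stay_inside:
  assumes \<epsilon>: "0 < \<epsilon>" "\<epsilon> \<le> u"
  obtains C where "0 \<le> C" "\<And>t T x. \<epsilon> \<le> t \<Longrightarrow> t \<le> u \<Longrightarrow>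
    prob {\<omega> \<in> space M. \<bar>B t \<omega>\<bar> < 1 \<and> occ t T \<omega> \<le> x}
    \<le> C * prob {\<omega> \<in> space M. occ 0 t \<omega> \<le> \<epsilon> / 2 \<and> occ t T \<omega> \<le> x}"
proof -
  \<comment> \<open>The mesh is at most \<open>u / n\<close>. The sum of the bounds for the end
    intervals and the inner ones is at most \<open>u / n * (2 + u)\<close>, and \<open>n\<close>
    makes this at most \<open>\<epsilon> / 4\<close>.\<close>
  define n where "n = nat \<lceil>4 * u * (2 + u) / \<epsilon>\<rceil> + 2"
  have "4 * u * (2 + u) / \<epsilon> \<le> real n" unfolding n_def by linarith
  then have "4 * u * (2 + u) \<le> \<epsilon> * real n" using \<epsilon> by (simp add: divide_le_eq mult.commute)
  moreover have n2: "2 \<le> n" by (simp add: n_def)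
  ultimately have n: "2 \<le> n" "u / real n * (2 + u) \<le> \<epsilon> / 4"
    by (auto simp: field_simps)
  \<comment> \<open>\<open>K\<close> bounds the endpoint values that occur: the start, where the
    path equals \<open>y\<close> almost surely, the pinned grid points, and
    \<open>B t\<close>.\<close>
  define K where "K = max 1 \<bar>y\<bar>"
  have K: "1 \<le> K" "\<bar>y\<bar> \<le> K" and K0: "0 \<le> K" by (auto simp: K_def)
  \<comment> \<open>The bridge over \<open>[j * \<delta>, t]\<close> at the next grid point has
    variance \<open>\<delta> * k / (k + 1)\<close> with \<open>k \<ge> 1\<close>, hence at least
    \<open>\<delta> / 2\<close>.\<close>
  define v0 where "v0 = \<epsilon> / (2 * real n)"
  have v0: "0 < v0" using \<epsilon> n by (simp add: v0_def)
  have "0 \<le> u / real n" using \<epsilon> by simp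
  from bridge_pull_in[OF v0 this K0] obtain C where C0: "0 \<le> C" and
    C': "\<forall>a m b. 0 \<le> a \<and> a < m \<and> m < b \<and> v0 \<le> (m - a) * (b - m) / (b - a) \<and> (m - a) * (b - m) / (b - a) \<le> u / real n \<longrightarrow>
      (\<forall>E\<in>sets (past_and_future a b). (\<forall>\<omega>\<in>E. \<bar>B a \<omega>\<bar> \<le> K \<and> \<bar>B b \<omega>\<bar> \<le> K) \<longrightarrow>
      prob E \<le> C * prob (E \<inter> {\<omega> \<in> space M. \<bar>B m \<omega>\<bar> \<le> 1 / 2}))"
    by blast
  have "prob {\<omega> \<in> space M. \<bar>B t \<omega>\<bar> < 1 \<and> occ t T \<omega> \<le> x}
    \<le> (C ^ (n - 1) * 2) * prob {\<omega> \<in> space M. occ 0 t \<omega> \<le> \<epsilon> / 2 \<and> occ t T \<omega> \<le> x}"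
    if t: "\<epsilon> \<le> t" "t \<le> u" for t T x
  proof -
    have t0: "0 < t" using t \<epsilon> by linarith
    define \<delta> where "\<delta> = t / real n"
    have \<delta>: "0 < \<delta>" "real n * \<delta> = t" "\<delta> \<le> u / real n" "\<epsilon> / real n \<le> \<delta>"
      using t0 n t by (auto simp: \<delta>_def divide_right_mono)
    \<comment> \<open>In \<open>E j\<close> the first \<open>j\<close> positive grid points are
      already pinned. The bound on \<open>B 0\<close> is built in because the start is known only
      almost surely.\<close>
    define E where "E = (\<lambda>j. {\<omega> \<in> space M. \<bar>B t \<omega>\<bar> < 1 \<and> occ t T \<omega> \<le> x \<and> \<bar>B 0 \<omega>\<bar> \<le> K \<and> (\<forall>i\<in>{1..j}. \<bar>B (real i * \<delta>) \<omega>\<bar> \<le> 1 / 2)})"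
    have EN: "E j \<in> sets (past_and_future a b)"
      if ab: "0 \<le> a" "b \<le> t" "\<And>i. i \<in> {1..j} \<Longrightarrow> real i * \<delta> \<le> a \<or> b \<le> real i * \<delta>" for j a b
    proof -
      have [measurable]: "B t \<in> borel_measurable (past_and_future a b)" "B 0 \<in> borel_measurable (past_and_future a b)"
        using ab by (auto intro!: measurable_past_and_future)
      have [measurable]: "occ t T \<in> borel_measurable (past_and_future a b)"
        using ab t0 by (auto intro!: occ_past_and_future)
      have [measurable]: "B (real i * \<delta>) \<in> borel_measurable (past_and_future a b)" if "i \<in> {1..j}" for i
        using ab(3)[OF that] \<delta> by (auto intro!: measurable_past_and_future)
      have "{\<omega> \<in> space (past_and_future a b). \<bar>B t \<omega>\<bar> < 1 \<and> occ t T \<omega> \<le> x \<and> \<bar>B 0 \<omega>\<bar> \<le> K \<and> (\<forall>i\<in>{1..j}. \<bar>B (real i * \<delta>) \<omega>\<bar> \<le> 1 / 2)}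
        \<in> sets (past_and_future a b)"
        by measurable
      then show ?thesis by (simp only: E_def space_past_and_future)
    qed
    have EM[measurable]: "E j \<in> events" for j
    proof -
      \<comment> \<open>For \<open>a = b = t\<close> this sigma-algebra sees all nonnegative
        times.\<close>
      have "E j \<in> sets (past_and_future t t)" by (rule EN) (use t0 in auto)
      then show ?thesis using sets_past_and_future_subset[of t t] t0 by auto
    qed
    \<comment> \<open>Resampling takes place on all of \<open>(j * \<delta>, t)\<close>, where
      \<open>E j\<close> imposes no condition, with \<open>B t\<close> held fixed.\<close>
    have step: "prob (E j) \<le> C * prob (E (Suc j))" if j: "Suc j < n" for j
    proof -
      define a m where "a = real j * \<delta>" and "m = real (Suc j) * \<delta>"
      have ma: "m - a = \<delta>" by (simp add: a_def m_def algebra_simps)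
      have tm: "t - m = (real n - real (Suc j)) * \<delta>" unfolding m_def \<delta>(2)[symmetric] by (simp add: algebra_simps)
      have ta: "t - a = (real n - real j) * \<delta>" unfolding a_def \<delta>(2)[symmetric] by (simp add: algebra_simps)
      have jn: "real (Suc j) + 1 \<le> real n" using j by linarith
      have a0: "0 \<le> a" using \<delta> by (simp add: a_def)
      have am: "a < m" using ma \<delta> by linarith
      have "0 < t - m" unfolding tm using jn \<delta> by (intro mult_pos_pos) auto
      then have mt: "m < t" by simp
      define k where "k = real n - real (Suc j)"
      have k: "1 \<le> k" using jn by (simp add: k_def)
      have "(m - a) * (t - m) / (t - a) = \<delta> * (k * \<delta>) / ((k + 1) * \<delta>)"
        unfolding ma tm ta by (simp add: k_def)
      also have "\<dots> = \<delta> * (k / (k + 1))" using nonzero_mult_divide_mult_cancel_right[of \<delta> "\<delta> * k" "k + 1"] \<delta>(1) by (simp add: mult.assoc)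
      finally have v: "(m - a) * (t - m) / (t - a) = \<delta> * (k / (k + 1))" .
      have kk: "1 / 2 \<le> k / (k + 1)" "k / (k + 1) \<le> 1" using k by (auto simp: field_simps)
      have "v0 \<le> \<delta> * (1 / 2)" using \<delta>(4) by (simp add: v0_def)
      also have "\<dots> \<le> \<delta> * (k / (k + 1))" using kk \<delta> by (intro mult_left_mono) auto
      finally have v1: "v0 \<le> (m - a) * (t - m) / (t - a)" unfolding v .
      have "\<delta> * (k / (k + 1)) \<le> \<delta> * 1" using kk \<delta> by (intro mult_left_mono) auto
      then have v2: "(m - a) * (t - m) / (t - a) \<le> u / real n" unfolding v using \<delta>(3) by linarith
      have "prob (E j) \<le> C * prob (E j \<inter> {\<omega> \<in> space M. \<bar>B m \<omega>\<bar> \<le> 1 / 2})"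
      proof (rule C'[rule_format])
        show "0 \<le> a \<and> a < m \<and> m < t \<and> v0 \<le> (m - a) * (t - m) / (t - a) \<and> (m - a) * (t - m) / (t - a) \<le> u / real n"
          using a0 am mt v1 v2 by blast
        show "E j \<in> sets (past_and_future a t)"
          by (rule EN) (use a0 \<delta> in \<open>auto simp: a_def\<close>)
        fix \<omega> assume w: "\<omega> \<in> E j"
        then have "\<bar>B t \<omega>\<bar> \<le> K" using K by (auto simp: E_def)
        moreover have "\<bar>B a \<omega>\<bar> \<le> K"
        proof (cases "j = 0")
          case True
          then show ?thesis using w by (simp add: E_def a_def)
        next
          case False
          then have "\<bar>B a \<omega>\<bar> \<le> 1 / 2" using w by (auto simp: E_def a_def)
          then show ?thesis using K by linarith
        qed
        ultimately show "\<bar>B a \<omega>\<bar> \<le> K \<and> \<bar>B t \<omega>\<bar> \<le> K" by simp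
      qed
      moreover have "E j \<inter> {\<omega> \<in> space M. \<bar>B m \<omega>\<bar> \<le> 1 / 2} = E (Suc j)"
        by (auto simp: E_def m_def atLeastAtMostSuc_conv)
      ultimately show ?thesis by simp
    qed
    have iter: "prob (E 0) \<le> C ^ j * prob (E j)" if "j < n" for j
      using that
    proof (induction j)
      case (Suc j)
      then have "prob (E 0) \<le> C ^ j * prob (E j)" by simp
      also have "\<dots> \<le> C ^ j * (C * prob (E (Suc j)))"
        using step[of j] Suc.prems C0 by (intro mult_left_mono) auto
      finally show ?case by (simp add: ac_simps)
    qed simp
    define F where "F = E (n - 1)"
    have [measurable]: "F \<in> events" by (simp add: F_def)
    have FE: "prob (E 0) \<le> C ^ (n - 1) * prob F" using iter[of "n - 1"] n by (simp add: F_def)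
    \<comment> \<open>In an inner grid interval the interpolation is at most \<open>1 / 2\<close> in
      modulus, so being outside forces a bridge of size \<open>1 / 2\<close>, of probability at most
      \<open>\<delta>\<close>. On the two end intervals the trivial bound \<open>prob F\<close> is
      used.\<close>
    have pt: "outside_prob F r * indicator {0..<t} r
        \<le> prob F * (indicator {0..<\<delta>} r + indicator {t - \<delta>..<t} r + \<delta> * indicator {0..<t} r)" for r
    proof (cases "r \<in> {\<delta>..<t - \<delta>}")
      case False
      have "outside_prob F r \<le> prob F" unfolding outside_prob_def by (rule finite_measure_mono) auto
      moreover have "indicator {0..<t} r \<le> (indicator {0..<\<delta>} r + indicator {t - \<delta>..<t} r + \<delta> * indicator {0..<t} r :: real)"
        using False \<delta> by (auto split: split_indicator)
      ultimately show ?thesis by (intro mult_mono) (auto simp: outside_prob_def)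
    next
      case True
      define j where "j = nat \<lfloor>r / \<delta>\<rfloor>"
      have "0 \<le> r / \<delta>" using True \<delta> by simp
      then have "real j \<le> r / \<delta>" "r / \<delta> < real j + 1" unfolding j_def by linarith+
      then have j: "real j * \<delta> \<le> r" "r < real (Suc j) * \<delta>" using \<delta> by (auto simp: field_simps)
      have "1 * \<delta> < real (Suc j) * \<delta>" using j(2) True by auto
      then have "1 < real (Suc j)" using mult_less_cancel_right_pos[OF \<delta>(1)] by blast
      then have j1: "1 \<le> j" by simp
      have "real j * \<delta> < (real n - 1) * \<delta>" using j(1) True \<delta>(2) by (auto simp: algebra_simps)
      then have "real j < real n - 1" using mult_less_cancel_right_pos[OF \<delta>(1)] by blast
      then have j2: "Suc j \<le> n - 1" by linarith
      have jt: "real (Suc j) * \<delta> \<le> t"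
        unfolding \<delta>(2)[symmetric] using j2 \<delta>(1) by (intro mult_right_mono) auto
      have inside: "\<bar>B (real j * \<delta>) \<omega>\<bar> \<le> 1 / 2" "\<bar>B (real (Suc j) * \<delta>) \<omega>\<bar> \<le> 1 / 2" if "\<omega> \<in> F" for \<omega>
        using that j1 j2 by (auto simp: F_def E_def simp del: of_nat_Suc)
      have "outside_prob F r \<le> \<delta> * prob F"
      \<comment> \<open>At a grid point no bridge is available, but there the path is pinned
        inside.\<close>
      proof (cases "real j * \<delta> = r")
        case True
        have "F \<inter> {\<omega> \<in> space M. 1 \<le> \<bar>B r \<omega>\<bar>} = {}"
          using inside(1) unfolding True by fastforce
        then show ?thesis using \<delta> by (simp add: outside_prob_def)
      next
        case False
        define a b where "a = real j * \<delta>" and "b = real (Suc j) * \<delta>"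
        have arb: "0 \<le> a" "a < r" "r < b" using j False \<delta> by (auto simp: a_def b_def simp del: of_nat_Suc)
        have ba: "b - a = \<delta>" by (simp add: a_def b_def algebra_simps)
        have FN: "F \<in> sets (past_and_future a b)"
          unfolding F_def
        proof (rule EN)
          fix i :: nat
          have "real i \<le> real j \<or> real (Suc j) \<le> real i"
            unfolding of_nat_le_iff by linarith
          then show "real i * \<delta> \<le> a \<or> b \<le> real i * \<delta>"
            unfolding a_def b_def using mult_le_cancel_right_pos[OF \<delta>(1)] by blast
        qed (use arb jt in \<open>auto simp: b_def simp del: of_nat_Suc\<close>)
        have "F \<inter> {\<omega> \<in> space M. 1 \<le> \<bar>B r \<omega>\<bar>} \<subseteq> F \<inter> {\<omega> \<in> space M. bridge a r b \<omega> \<in> {z. 1 / 2 \<le> \<bar>z\<bar>}}"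
        proof
          fix \<omega> assume w: "\<omega> \<in> F \<inter> {\<omega> \<in> space M. 1 \<le> \<bar>B r \<omega>\<bar>}"
          define X where "X = ((b - r) * B a \<omega> + (r - a) * B b \<omega>) / (b - a)"
          have "\<bar>(b - r) * B a \<omega> + (r - a) * B b \<omega>\<bar> \<le> (b - r) * (1 / 2) + (r - a) * (1 / 2)"
            using inside[of \<omega>] w arb unfolding a_def[symmetric] b_def[symmetric]
            by (intro order_trans[OF abs_triangle_ineq] add_mono) (auto simp: abs_mult intro!: mult_left_mono)
          also have "\<dots> = 1 / 2 * (b - a)" by (simp add: field_simps)
          finally have "\<bar>X\<bar> \<le> 1 / 2" using arb by (simp add: X_def divide_le_eq)
          moreover have "1 \<le> \<bar>B r \<omega>\<bar>" using w by auto
          moreover have "B r \<omega> = bridge a r b \<omega> + X" by (simp add: bridge_def X_def)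
          ultimately have "1 / 2 \<le> \<bar>bridge a r b \<omega>\<bar>" by linarith
          then show "\<omega> \<in> F \<inter> {\<omega> \<in> space M. bridge a r b \<omega> \<in> {z. 1 / 2 \<le> \<bar>z\<bar>}}" using w by auto
        qed
        moreover have "{\<omega> \<in> space M. bridge a r b \<omega> \<in> {z. 1 / 2 \<le> \<bar>z\<bar>}} \<in> events"
        proof -
          have [measurable]: "bridge a r b \<in> borel_measurable M"
            using bridge_distributed[OF arb] by (auto simp: distributed_def)
          show ?thesis by measurable
        qed
        ultimately have "outside_prob F r \<le> prob (F \<inter> {\<omega> \<in> space M. bridge a r b \<omega> \<in> {z. 1 / 2 \<le> \<bar>z\<bar>}})"
          unfolding outside_prob_def by (intro finite_measure_mono sets.Int) auto
        also have "\<dots> = prob F * prob {\<omega> \<in> space M. bridge a r b \<omega> \<in> {z. 1 / 2 \<le> \<bar>z\<bar>}}"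
          by (rule prob_bridge[OF arb FN]) measurable
        also have "\<dots> \<le> prob F * \<delta>"
        proof (rule mult_left_mono)
          define v where "v = (r - a) * (b - r) / (b - a)"
          \<comment> \<open>The bridge variance is at most \<open>\<delta> / 4\<close>, which
            cancels the factor 4 of Chebyshev's inequality at level \<open>1 / 2\<close>.\<close>
          have "(r - a) * (b - r) \<le> \<delta> * \<delta> / 4"
          proof -
            have "4 * ((r - a) * (b - r)) = (b - a)\<^sup>2 - ((r - a) - (b - r))\<^sup>2" by (simp add: power2_eq_square algebra_simps)
            also have "\<dots> \<le> (b - a)\<^sup>2" by simp
            finally show ?thesis unfolding ba by (simp add: power2_eq_square)
          qed
          then have "v \<le> \<delta> / 4" unfolding v_def ba using \<delta>(1) by (simp add: field_simps)
          moreover have "0 < v" using arb by (simp add: v_def)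
          moreover have "prob {\<omega> \<in> space M. 1 / 2 \<le> \<bar>bridge a r b \<omega>\<bar>} \<le> v / (1 / 2)\<^sup>2"
            by (rule normal_prob_tail_le[OF _ \<open>0 < v\<close>]) (use bridge_distributed[OF arb] in \<open>simp_all add: v_def\<close>)
          ultimately show "prob {\<omega> \<in> space M. bridge a r b \<omega> \<in> {z. 1 / 2 \<le> \<bar>z\<bar>}} \<le> \<delta>"
            by (simp add: power2_eq_square)
        qed simp
        finally show ?thesis by (simp add: mult.commute)
      qed
      then show ?thesis using True \<delta> t0 by (auto split: split_indicator simp: mult.commute)
    qed
    \<comment> \<open>Markov's inequality: \<open>\<epsilon> / 2\<close> times the probability of
      \<open>H\<close> is at most \<open>\<epsilon> / 4\<close> times that of \<open>F\<close>, so
      at least half of \<open>F\<close> spends at most \<open>\<epsilon> / 2\<close> outside before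
      \<open>t\<close>.\<close>
    define H where "H = F \<inter> {\<omega> \<in> space M. \<epsilon> / 2 < occ 0 t \<omega>}"
    have [measurable]: "H \<in> events" unfolding H_def by measurable
    have "ennreal (\<epsilon> / 2 * prob H) = (\<integral>\<^sup>+\<omega>. ennreal (\<epsilon> / 2) * indicator H \<omega> \<partial>M)"
      using \<epsilon> by (subst nn_integral_cmult_indicator) (auto simp: emeasure_eq_measure ennreal_mult'[symmetric])
    also have "\<dots> \<le> (\<integral>\<^sup>+\<omega>\<in>F. ennreal (occ 0 t \<omega>) \<partial>M)"
      by (intro nn_integral_mono) (auto simp: H_def split: split_indicator intro!: ennreal_leI)
    also have "\<dots> = (\<integral>\<^sup>+r. ennreal (outside_prob F r * indicator {0..<t} r) \<partial>lborel)"
      by (rule outside_prob_Fubini(2)[symmetric]) auto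
    also have "\<dots> \<le> (\<integral>\<^sup>+r. ennreal (prob F) * (indicator {0..<\<delta>} r + indicator {t - \<delta>..<t} r + ennreal \<delta> * indicator {0..<t} r) \<partial>lborel)"
    proof (rule nn_integral_mono)
      fix r
      have "ennreal (outside_prob F r * indicator {0..<t} r)
          \<le> ennreal (prob F * (indicator {0..<\<delta>} r + indicator {t - \<delta>..<t} r + \<delta> * indicator {0..<t} r))"
        by (rule ennreal_leI[OF pt])
      also have "\<dots> = ennreal (prob F) * (indicator {0..<\<delta>} r + indicator {t - \<delta>..<t} r + ennreal \<delta> * indicator {0..<t} r)"
        using \<delta>(1) by (simp add: ennreal_mult' ennreal_plus ennreal_indicator)
      finally show "ennreal (outside_prob F r * indicator {0..<t} r)
          \<le> ennreal (prob F) * (indicator {0..<\<delta>} r + indicator {t - \<delta>..<t} r + ennreal \<delta> * indicator {0..<t} r)" .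
    qed
    also have "\<dots> = ennreal (prob F) * (ennreal \<delta> + ennreal \<delta> + ennreal \<delta> * ennreal t)"
      using \<delta>(1) t0 by (simp add: nn_integral_cmult nn_integral_add)
    also have "ennreal \<delta> + ennreal \<delta> + ennreal \<delta> * ennreal t = ennreal (\<delta> + \<delta> + \<delta> * t)"
      using \<delta>(1) t0 ennreal_plus[of "\<delta> + \<delta>" "\<delta> * t"] ennreal_plus[of \<delta> \<delta>] ennreal_mult[of \<delta> t] by simp
    also have "ennreal (prob F) * \<dots> = ennreal (prob F * (\<delta> + \<delta> + \<delta> * t))"
      by (rule ennreal_mult'[symmetric]) simp
    finally have "\<epsilon> / 2 * prob H \<le> prob F * (\<delta> + \<delta> + \<delta> * t)"
      using \<delta>(1) t0 by (subst (asm) ennreal_le_iff) auto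
    also have "\<dots> \<le> prob F * (\<epsilon> / 4)"
    proof (rule mult_left_mono)
      have "\<delta> + \<delta> + \<delta> * t = \<delta> * (2 + t)" by (simp add: algebra_simps)
      also have "\<dots> \<le> u / real n * (2 + u)" using \<delta> t t0 by (intro mult_mono) auto
      finally show "\<delta> + \<delta> + \<delta> * t \<le> \<epsilon> / 4" using n(2) by linarith
    qed simp
    finally have PH: "prob H \<le> prob F / 2" using \<epsilon> by (simp add: field_simps)
    define G where "G = {\<omega> \<in> space M. occ 0 t \<omega> \<le> \<epsilon> / 2 \<and> occ t T \<omega> \<le> x}"
    have [measurable]: "occ t T \<in> borel_measurable M" "B t \<in> borel_measurable M" using t0 by (auto intro!: random_variable)
    have [measurable]: "G \<in> events" unfolding G_def by measurable
    have "F \<subseteq> H \<union> G"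
    proof
      fix \<omega> assume w: "\<omega> \<in> F"
      then have "\<omega> \<in> space M" "occ t T \<omega> \<le> x" by (simp_all add: F_def E_def)
      then show "\<omega> \<in> H \<union> G" using w by (auto simp: H_def G_def)
    qed
    then have "prob F \<le> prob (H \<union> G)"
      by (rule finite_measure_mono) measurable
    also have "\<dots> \<le> prob H + prob G" by (rule measure_Un_le) measurable
    finally have FG: "prob F \<le> 2 * prob G" using PH by linarith
    have "prob {\<omega> \<in> space M. \<bar>B t \<omega>\<bar> < 1 \<and> occ t T \<omega> \<le> x} \<le> prob (E 0)"
    proof (rule finite_measure_mono_AE)
      show "AE \<omega> in M. \<omega> \<in> {\<omega> \<in> space M. \<bar>B t \<omega>\<bar> < 1 \<and> occ t T \<omega> \<le> x} \<longrightarrow> \<omega> \<in> E 0"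
        using start by eventually_elim (use K in \<open>auto simp: E_def\<close>)
    qed measurable
    also note FE
    also have "C ^ (n - 1) * prob F \<le> C ^ (n - 1) * (2 * prob G)"
      using FG C0 by (intro mult_left_mono) auto
    finally show ?thesis by (simp add: G_def)
  qed
  with that[of "C ^ (n - 1) * 2"] C0 show ?thesis by simp
qed

section \<open>Late hitting\<close>

text \<open>On the left-hand event at most \<open>s - \<epsilon>\<close> of the budget remains after
  \<open>\<epsilon>\<close>, whereas \<open>[\<epsilon>, 2 * s)\<close> has length
  \<open>2 * s - \<epsilon>\<close>, so the path is inside for time at least \<open>s\<close> there.
  The pointwise comparison at such inside times is integrated over the interval.\<close>

lemma late_hitting_bound:
  assumes s: "0 < s" and \<epsilon>: "0 < \<epsilon>" "\<epsilon> \<le> s"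
  obtains C where "0 \<le> C" "\<And>T. 2 * s \<le> T \<Longrightarrow>
    prob {\<omega> \<in> space M. \<epsilon> \<le> occ 0 \<epsilon> \<omega> \<and> occ 0 T \<omega> \<le> s} \<le> C * prob {\<omega> \<in> space M. occ 0 T \<omega> \<le> s - \<epsilon> / 2}"
proof -
  have \<epsilon>s: "\<epsilon> \<le> 2 * s" using s \<epsilon> by linarith
  obtain C where C0: "0 \<le> C" and C: "\<And>t T x. \<epsilon> \<le> t \<Longrightarrow> t \<le> 2 * s \<Longrightarrow>
    prob {\<omega> \<in> space M. \<bar>B t \<omega>\<bar> < 1 \<and> occ t T \<omega> \<le> x}
    \<le> C * prob {\<omega> \<in> space M. occ 0 t \<omega> \<le> \<epsilon> / 2 \<and> occ t T \<omega> \<le> x}"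
    using stay_inside[OF \<epsilon>(1) \<epsilon>s] by blast
  have "prob {\<omega> \<in> space M. \<epsilon> \<le> occ 0 \<epsilon> \<omega> \<and> occ 0 T \<omega> \<le> s} \<le> (2 * C) * prob {\<omega> \<in> space M. occ 0 T \<omega> \<le> s - \<epsilon> / 2}"
    if T: "2 * s \<le> T" for T
  proof -
    define A where "A = {\<omega> \<in> space M. \<epsilon> \<le> occ 0 \<epsilon> \<omega> \<and> occ 0 T \<omega> \<le> s}"
    define G where "G = {\<omega> \<in> space M. occ 0 T \<omega> \<le> s - \<epsilon> / 2}"
    have [measurable]: "A \<in> events" "G \<in> events" unfolding A_def G_def by measurable
    have late: "occ \<epsilon> t \<omega> + occ t T \<omega> \<le> s - \<epsilon>" if "\<omega> \<in> A" "\<epsilon> \<le> t" "t \<le> 2 * s" for \<omega> t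
    proof -
      have "\<omega> \<in> space M" "\<epsilon> \<le> occ 0 \<epsilon> \<omega>" "occ 0 T \<omega> \<le> s" using that by (auto simp: A_def)
      moreover have "occ 0 T \<omega> = occ 0 \<epsilon> \<omega> + occ \<epsilon> T \<omega>" "occ \<epsilon> T \<omega> = occ \<epsilon> t \<omega> + occ t T \<omega>"
        using that \<epsilon> T \<epsilon>s calculation(1) by (auto intro!: occ_split)
      ultimately show ?thesis by linarith
    qed
    \<comment> \<open>If the path is inside at \<open>t\<close>, \<open>stay_inside\<close> replaces
      its beginning at a constant cost, and the new total is at most
      \<open>\<epsilon> / 2 + (s - \<epsilon>)\<close>.\<close>
    have pt: "prob A \<le> outside_prob A t + C * prob G" if t: "t \<in> {\<epsilon>..<2 * s}" for t
    proof -
      have t0: "0 \<le> t" using t \<epsilon> by auto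
      have [measurable]: "B t \<in> borel_measurable M" "occ t T \<in> borel_measurable M"
        using t0 by (auto intro!: random_variable)
      let ?F = "{\<omega> \<in> space M. \<bar>B t \<omega>\<bar> < 1 \<and> occ t T \<omega> \<le> s - \<epsilon>}"
      have "A \<subseteq> (A \<inter> {\<omega> \<in> space M. 1 \<le> \<bar>B t \<omega>\<bar>}) \<union> ?F"
      proof
        fix \<omega> assume w: "\<omega> \<in> A"
        have "occ t T \<omega> \<le> s - \<epsilon>"
          using late[OF w, of t] occ_nonneg[of \<epsilon> t \<omega>] t by (auto simp del: occ_nonneg)
        moreover have "\<omega> \<in> space M" using w by (simp add: A_def)
        ultimately show "\<omega> \<in> (A \<inter> {\<omega> \<in> space M. 1 \<le> \<bar>B t \<omega>\<bar>}) \<union> ?F" using w by auto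
      qed
      then have "prob A \<le> prob ((A \<inter> {\<omega> \<in> space M. 1 \<le> \<bar>B t \<omega>\<bar>}) \<union> ?F)"
        by (intro finite_measure_mono) measurable
      also have "\<dots> \<le> outside_prob A t + prob ?F"
        unfolding outside_prob_def by (rule measure_Un_le) measurable
      also have "prob ?F \<le> C * prob {\<omega> \<in> space M. occ 0 t \<omega> \<le> \<epsilon> / 2 \<and> occ t T \<omega> \<le> s - \<epsilon>}"
        by (rule C) (use t in auto)
      also have "\<dots> \<le> C * prob G"
      proof (intro mult_left_mono finite_measure_mono C0)
        show "{\<omega> \<in> space M. occ 0 t \<omega> \<le> \<epsilon> / 2 \<and> occ t T \<omega> \<le> s - \<epsilon>} \<subseteq> G"
        proof
          fix \<omega> assume w: "\<omega> \<in> {\<omega> \<in> space M. occ 0 t \<omega> \<le> \<epsilon> / 2 \<and> occ t T \<omega> \<le> s - \<epsilon>}"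
          then have "occ 0 T \<omega> = occ 0 t \<omega> + occ t T \<omega>" using t T t0 by (intro occ_split) auto
          moreover have "occ 0 t \<omega> \<le> \<epsilon> / 2" "occ t T \<omega> \<le> s - \<epsilon>" using w by auto
          ultimately have "occ 0 T \<omega> \<le> s - \<epsilon> / 2" by linarith
          then show "\<omega> \<in> G" using w by (simp add: G_def)
        qed
      qed measurable
      finally show ?thesis by simp
    qed
    have [measurable]: "(\<lambda>t. outside_prob A t * indicator {\<epsilon>..<2 * s} t) \<in> borel_measurable borel"
      using outside_prob_Fubini(1)[of A \<epsilon> "2 * s"] \<epsilon> by simp
    have "ennreal ((2 * s - \<epsilon>) * prob A) = (\<integral>\<^sup>+t. ennreal (prob A) * indicator {\<epsilon>..<2 * s} t \<partial>lborel)"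
      using \<epsilon>s by (subst nn_integral_cmult_indicator) (auto simp: ennreal_mult'[symmetric] mult.commute)
    also have "\<dots> \<le> (\<integral>\<^sup>+t. ennreal (outside_prob A t * indicator {\<epsilon>..<2 * s} t) + ennreal (C * prob G) * indicator {\<epsilon>..<2 * s} t \<partial>lborel)"
    proof (rule nn_integral_mono)
      fix t :: real
      show "ennreal (prob A) * indicator {\<epsilon>..<2 * s} t
          \<le> ennreal (outside_prob A t * indicator {\<epsilon>..<2 * s} t) + ennreal (C * prob G) * indicator {\<epsilon>..<2 * s} t"
      proof (cases "t \<in> {\<epsilon>..<2 * s}")
        case True
        have "ennreal (prob A) \<le> ennreal (outside_prob A t + C * prob G)" by (rule ennreal_leI[OF pt[OF True]])
        also have "\<dots> = ennreal (outside_prob A t) + ennreal (C * prob G)"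
          using C0 by (intro ennreal_plus) (auto simp: outside_prob_def)
        finally show ?thesis using True by simp
      qed simp
    qed
    also have "\<dots> = (\<integral>\<^sup>+t. ennreal (outside_prob A t * indicator {\<epsilon>..<2 * s} t) \<partial>lborel)
        + ennreal (C * prob G) * ennreal (2 * s - \<epsilon>)"
      using \<epsilon>s by (subst nn_integral_add) (simp_all add: nn_integral_cmult_indicator)
    also have "\<dots> \<le> ennreal ((s - \<epsilon>) * prob A) + ennreal (C * prob G) * ennreal (2 * s - \<epsilon>)"
    proof (intro add_right_mono integrated_outside_prob_le)
      fix \<omega> assume "\<omega> \<in> A"
      from late[OF this, of "2 * s"] \<epsilon>s occ_nonneg[of "2 * s" T \<omega>] show "occ \<epsilon> (2 * s) \<omega> \<le> s - \<epsilon>"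
        by linarith
    qed (use \<epsilon> in auto)
    also have "\<dots> = ennreal ((s - \<epsilon>) * prob A + C * prob G * (2 * s - \<epsilon>))"
      using \<epsilon> \<epsilon>s C0 by (simp add: ennreal_plus[symmetric] ennreal_mult'[symmetric] del: ennreal_plus)
    finally have "(2 * s - \<epsilon>) * prob A \<le> (s - \<epsilon>) * prob A + C * prob G * (2 * s - \<epsilon>)"
      using \<epsilon> \<epsilon>s C0 by (subst (asm) ennreal_le_iff) auto
    moreover have "C * prob G * (2 * s - \<epsilon>) \<le> C * prob G * (2 * s)"
      using \<epsilon> C0 by (intro mult_left_mono) auto
    \<comment> \<open>The difference of \<open>2 * s - \<epsilon>\<close> and
      \<open>s - \<epsilon>\<close> is \<open>s\<close>, so the final constant \<open>2 * C\<close>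
      is independent of \<open>T\<close>.\<close>
    ultimately have "s * prob A \<le> s * (2 * C * prob G)" by (simp add: algebra_simps)
    then show ?thesis unfolding A_def[symmetric] G_def[symmetric] using s by simp
  qed
  with that[of "2 * C"] C0 show ?thesis by simp
qed

text \<open>A path that starts outside and is inside at some \<open>t < \<epsilon>\<close> passes
  through modulus 1 by the intermediate value theorem, so it would have been hit before
  \<open>\<epsilon>\<close>.\<close>

lemma late_hitting_time_imp_occ:
  assumes \<omega>: "\<omega> \<in> space M" "B 0 \<omega> = y" and y: "1 < \<bar>y\<bar>" and \<epsilon>: "0 < \<epsilon>" "ereal \<epsilon> \<le> hitting_time B \<omega>"
  shows "\<epsilon> \<le> occ 0 \<epsilon> \<omega>"
proof -
  have out: "1 \<le> \<bar>B t \<omega>\<bar>" if t: "0 \<le> t" "t < \<epsilon>" for t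
  proof (rule ccontr)
    assume "\<not> 1 \<le> \<bar>B t \<omega>\<bar>"
    moreover have "continuous_on {0..t} (\<lambda>r. \<bar>B r \<omega>\<bar>)"
      using continuous_paths[OF \<omega>(1)] by (intro continuous_intros) (auto intro: continuous_on_subset)
    ultimately obtain r where r: "0 \<le> r" "r \<le> t" "\<bar>B r \<omega>\<bar> = 1"
      using IVT2'[of "\<lambda>r. \<bar>B r \<omega>\<bar>" t 1 0] y \<omega>(2) t by auto
    have "hitting_time B \<omega> \<le> ereal r"
      unfolding hitting_time_def using r by (intro INF_lower) auto
    with \<epsilon>(2) have "ereal \<epsilon> \<le> ereal r" by (rule order_trans)
    with r t show False by simp
  qed
  have "{t \<in> {0..<\<epsilon>}. 1 \<le> \<bar>B t \<omega>\<bar>} = {0..<\<epsilon>}" using out by auto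
  then show ?thesis using \<epsilon>(1) by (simp add: occ_def)
qed

theorem late_hitting_conditional_limit:
  assumes s: "0 < s" and y: "1 < \<bar>y\<bar>" and \<epsilon>: "0 < \<epsilon>"
  shows "((\<lambda>T. \<P>(\<omega> in M. ereal \<epsilon> \<le> hitting_time B \<omega> \<bar> occupation_time B T \<omega> \<le> s)) \<longlongrightarrow> 0) at_top"
proof -
  define num where "num = (\<lambda>T. prob {\<omega> \<in> space M. ereal \<epsilon> \<le> hitting_time B \<omega> \<and> occupation_time B T \<omega> \<le> s})"
  define den where "den = (\<lambda>T. prob {\<omega> \<in> space M. occupation_time B T \<omega> \<le> s})"
  have den: "den T = prob {\<omega> \<in> space M. occ 0 T \<omega> \<le> s}" if "0 \<le> T" for T
    unfolding den_def using that by (intro arg_cong[where f=prob]) (auto simp: occupation_time_eq)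
  \<comment> \<open>If the event of \<open>num\<close> were not measurable, its measure would be \<open>0\<close>, so an almost sure inclusion suffices.\<close>
  have num: "num T \<le> prob {\<omega> \<in> space M. \<epsilon> \<le> occ 0 \<epsilon> \<omega> \<and> occ 0 T \<omega> \<le> s}" if "0 \<le> T" for T
    unfolding num_def
  proof (rule finite_measure_mono_AE)
    show "AE \<omega> in M. \<omega> \<in> {\<omega> \<in> space M. ereal \<epsilon> \<le> hitting_time B \<omega> \<and> occupation_time B T \<omega> \<le> s}
      \<longrightarrow> \<omega> \<in> {\<omega> \<in> space M. \<epsilon> \<le> occ 0 \<epsilon> \<omega> \<and> occ 0 T \<omega> \<le> s}"
      using start
      by eventually_elim (use that y \<epsilon> in \<open>auto simp: occupation_time_eq late_hitting_time_imp_occ\<close>)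
  qed measurable
  \<comment> \<open>A common form for both cases, from which the conditional probability is at most
    \<open>D / (T - T0)\<close>.\<close>
  have "\<exists>D T0. 0 \<le> D \<and> (\<forall>T>T0. 0 \<le> T \<and> num T \<le> D / (T - T0) * den T)"
  proof (cases "\<epsilon> \<le> s")
    case True
    obtain C where C: "0 \<le> C" "\<And>T. 2 * s \<le> T \<Longrightarrow>
      prob {\<omega> \<in> space M. \<epsilon> \<le> occ 0 \<epsilon> \<omega> \<and> occ 0 T \<omega> \<le> s} \<le> C * prob {\<omega> \<in> space M. occ 0 T \<omega> \<le> s - \<epsilon> / 2}"
      using late_hitting_bound[OF s \<epsilon> True] by blast
    have h: "0 < \<epsilon> / 2" "0 \<le> s - \<epsilon> / 2" using \<epsilon> True by auto
    obtain C' where C': "0 \<le> C'" "\<And>T. \<epsilon> / 2 \<le> T \<Longrightarrow> (T - \<epsilon> / 2 - 2 * (s - \<epsilon> / 2)) * prob {\<omega> \<in> space M. occ 0 T \<omega> \<le> s - \<epsilon> / 2}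
        \<le> C' * prob {\<omega> \<in> space M. occ 0 T \<omega> \<le> s - \<epsilon> / 2 + \<epsilon> / 2}"
      using occ_trade_off[OF h] by blast
    have "0 \<le> T \<and> num T \<le> C * C' / (T - 2 * s) * den T" if T: "2 * s < T" for T
    proof -
      have T0: "0 \<le> T" using T s by linarith
      let ?p = "prob {\<omega> \<in> space M. occ 0 T \<omega> \<le> s - \<epsilon> / 2}"
      have "(T - 2 * s) * ?p \<le> (T - \<epsilon> / 2 - 2 * (s - \<epsilon> / 2)) * ?p"
        using \<epsilon> by (intro mult_right_mono) auto
      also have "\<dots> \<le> C' * den T" using C'(2)[of T] T True \<epsilon> s den[OF T0] by simp
      finally have p: "?p \<le> C' / (T - 2 * s) * den T" using T by (simp add: field_simps)
      have "num T \<le> C * ?p" using num[OF T0] C(2)[of T] T by linarith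
      also have "\<dots> \<le> C * (C' / (T - 2 * s) * den T)" using p C(1) by (intro mult_left_mono)
      finally show ?thesis using T0 by simp
    qed
    with C(1) C'(1) show ?thesis by (intro exI[of _ "C * C'"] exI[of _ "2 * s"]) auto
  next
    case False
    have "num T \<le> 0" if T: "\<epsilon> < T" for T
    proof -
      have T0: "0 \<le> T" using T \<epsilon> by linarith
      have "\<not> (\<epsilon> \<le> occ 0 \<epsilon> \<omega> \<and> occ 0 T \<omega> \<le> s)" if "\<omega> \<in> space M" for \<omega>
        using occ_split[of 0 \<epsilon> T \<omega>] occ_nonneg[of \<epsilon> T \<omega>] that T \<epsilon> False by linarith
      then have empty: "{\<omega> \<in> space M. \<epsilon> \<le> occ 0 \<epsilon> \<omega> \<and> occ 0 T \<omega> \<le> s} = {}" by blast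
      show ?thesis using num[OF T0] unfolding empty by simp
    qed
    then show ?thesis using \<epsilon> by (intro exI[of _ 0] exI[of _ \<epsilon>]) auto
  qed
  then obtain D T0 where D: "0 \<le> D" "\<And>T. T0 < T \<Longrightarrow> num T \<le> D / (T - T0) * den T" by auto
  have "((\<lambda>T. num T / den T) \<longlongrightarrow> 0) at_top"
  proof (rule tendsto_sandwich)
    show "\<forall>\<^sub>F T in at_top. 0 \<le> num T / den T" by (simp add: num_def den_def)
    show "\<forall>\<^sub>F T in at_top. num T / den T \<le> D / (T - T0)"
      using eventually_gt_at_top[of T0]
    proof eventually_elim
      case (elim T)
      show ?case
      proof (cases "den T = 0")
        case False
        then have "0 < den T" by (simp add: den_def zero_less_measure_iff)
        then show ?thesis using D(2)[OF elim] by (simp add: divide_le_eq)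
      qed (use D(1) elim in simp)
    qed
    show "((\<lambda>T. D / (T - T0)) \<longlongrightarrow> 0) at_top"
      using filterlim_tendsto_add_at_top[OF tendsto_const[of "- T0"] filterlim_ident]
      by (intro tendsto_divide_0[OF tendsto_const] filterlim_at_top_imp_at_infinity) simp
  qed simp
  then show ?thesis by (simp add: cond_prob_def num_def den_def)
qed

end

theorem corollary3:
  fixes M :: "'a measure" and B :: "real \<Rightarrow> 'a \<Rightarrow> real" and y s \<epsilon> :: real
  assumes "brownian_motion M B y"
    and "0 < s"
    and "1 < \<bar>y\<bar>"
    and "0 < \<epsilon>"
  shows "((\<lambda>T. \<P>(\<omega> in M. ereal \<epsilon> \<le> hitting_time B \<omega> \<bar> occupation_time B T \<omega> \<le> s))
    \<longlongrightarrow> 0) at_top"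
  using brownian_motion.late_hitting_conditional_limit[OF assms] .

end
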